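(* Let $n\ge 4$ be even and let $s=(1,n)(2,n-1)\cdots(\frac n2,\frac n2+1)\in D_n\subset S_n$. Let $\chi(s)$ be the trace of the representation of $s$ on $\overline{FK}_{C_n}(n)$. Then $$[\chi(s)](q)=\sum_{k=0}^{\lfloor \frac n4\rfloor}\binom{\frac n2-k}{k}q^{2k}-2\sum_{k=0}^{\lfloor\frac{\frac n2-1}{2}\rfloor}\binom{\frac n2-1-k}{k}q^{2k+1}+\sum_{k=0}^{\lfloor\frac{\frac n2-2}{2}\rfloor}\binom{\frac n2-2-k}{k}q^{2k+2}.$$ In terms of $q$-Fibonacci polynomials, $$[\chi(s)](q)=F_{\frac n2}(q^2)-2qF_{\frac n2-1}(q^2)+q^2F_{\frac n2-2}(q^2).$$
   Context: Let $F$ be a field and $n>3$. $\overline{FK}_{C_n}(n)$ is the quotient of the Fomin-Kirillov algebra $FK(n)$ by the ideal generated by the $x_{ij}$ for which $\{i,j\}$ is not an edge of the $n$-cycle $C_n$ (vertices $1,\dots,n$, edges $\overline{12},\overline{23},\dots,\overline{n-1,n},\overline{1n}$). Explicitly, it is the associative unital $F$-algebra on generators $x_{1n}=-x_{n1}$ and $x_{m,m+1}=-x_{m+1,m}$ ($1\le m\le n-1$), that is, the free associative algebra on the $n$ letters $x_{12},x_{23},\dots,x_{n-1,n},x_{1n}$ modulo the two-sided ideal generated by the relations - $x_{m,m+1}^2=0$ for $1\le m\le n-1$, and $x_{1n}^2=0$; - $x_{m,m+1}x_{m+1,m+2}=0$ and $x_{m+1,m+2}x_{m,m+1}=0$ for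 $1\le m\le n-2$; - $x_{n-1,n}x_{1n}=0$, $x_{1n}x_{n-1,n}=0$, $x_{12}x_{1n}=0$, $x_{1n}x_{12}=0$; - $x_{m,m+1}x_{l,l+1}-x_{l,l+1}x_{m,m+1}=0$ for $1\le m\le l-2$, $3\le l\le n-1$; - $x_{m,m+1}x_{1n}-x_{1n}x_{m,m+1}=0$ for $2\le m\le n-2$. The algebra is graded by usual (total) degree, each generator having degree 1. The dihedral group $D_n=\langle r,s\mid s^2=r^n=(rs)^2=1\rangle$ is realized in $S_n$ as the symmetry group of the $n$-cycle, with $r=(1\,2\,\cdots\,n)$ and $s$ the permutation $i\mapsto n+1-i$. It acts on $\overline{FK}_{C_n}(n)$ by degree-preserving algebra automorphisms determined by $\sigma x_{ij}=x_{\sigma(i)\sigma(j)}$ if $\sigma(i)<\sigma(j)$ and $\sigma x_{ij}=-x_{\sigma(j)\sigma(i)}$ otherwise (extended multiplicatively to monomials and linearly). $[\chi(\sigma)](q)=\sum_{d\ge0}\operatorname{tr}\big(\sigma\,|\,\overline{FK}^{(d)}_{C_n}(n)\big)q^d$ is the graded trace (total degree decomposition), where $\overline{FK}^{(d)}_{C_n}(n)$ is the degree $d$ component. The $q$-Fibonacci polynomials are $F_m(q)=\sum_{k=0}^{\lfloor m/2\rfloor}\binom{m-k}{k}q^k$ for $m\ge0$. *)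

theory Defs
  imports
    "HOL-Algebra.QuotRing"
    "HOL-Library.Poly_Mapping"
    "HOL-Computational_Algebra.Formal_Power_Series"
    "Jordan_Normal_Form.VS_Connect"
begin

hide_const (open) Multiset.mult Polynomial.smult

section \<open>Free associative algebras\<close>

text \<open>
  Words under concatenation form the free monoid, written additively because this is what
  \<^typ>\<open>'w \<Rightarrow>\<^sub>0 'a\<close> expects of its index type.  Hence \<open>'l list \<Rightarrow>\<^sub>0 'a\<close> with
  its library ring structure is the free associative unital algebra on the letters \<open>'l\<close>;
  \<open>Poly_Mapping.single w c\<close> is the word \<open>w\<close> with coefficient \<open>c\<close>.
\<close>

instantiation list :: (type) monoid_add
begin

definition zero_list :: "'a list" where "zero_list = []"

definition plus_list :: "'a list \<Rightarrow> 'a list \<Rightarrow> 'a list" where "plus_list = append"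

instance
  by standard (simp_all add: zero_list_def plus_list_def)

end

type_synonym 'a nc_poly = "(nat \<times> nat) list \<Rightarrow>\<^sub>0 'a"

definition scalar :: "'a \<Rightarrow> 'a::field nc_poly" where
  "scalar c = Poly_Mapping.single [] c"

text \<open>The letters \<open>(i, j)\<close> with \<open>i < j\<close>, one for each edge of the \<open>n\<close>-cycle.\<close>

definition cycle_edges :: "nat \<Rightarrow> (nat \<times> nat) set" where
  "cycle_edges n = {(m, m + 1) | m. 1 \<le> m \<and> m \<le> n - 1} \<union> {(1, n)}"

definition free_algebra :: "nat \<Rightarrow> 'a::field nc_poly ring" where
  "free_algebra n =
     \<lparr>carrier = {p. Poly_Mapping.keys p \<subseteq> lists (cycle_edges n)},
      mult = (*), one = 1, zero = 0, add = (+)\<rparr>"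

text \<open>The generator $x_{ij}$, with the convention $x_{ji} = -x_{ij}$.\<close>

definition X :: "nat \<Rightarrow> nat \<Rightarrow> 'a::field nc_poly" where
  "X i j = (if i < j then Poly_Mapping.single [(i, j)] 1 else - Poly_Mapping.single [(j, i)] 1)"


section \<open>The quotient of the Fomin-Kirillov algebra attached to the n-cycle\<close>

definition relations :: "nat \<Rightarrow> 'a::field nc_poly set" where
  "relations n =
     {X m (m+1) * X m (m+1) | m. 1 \<le> m \<and> m \<le> n - 1} \<union> {X 1 n * X 1 n} \<union>
     {X m (m+1) * X (m+1) (m+2) | m. 1 \<le> m \<and> m \<le> n - 2} \<union>
     {X (m+1) (m+2) * X m (m+1) | m. 1 \<le> m \<and> m \<le> n - 2} \<union>
     {X (n-1) n * X 1 n, X 1 n * X (n-1) n, X 1 2 * X 1 n, X 1 n * X 1 2} \<union>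
     {X m (m+1) * X l (l+1) - X l (l+1) * X m (m+1) | m l.
        1 \<le> m \<and> m + 2 \<le> l \<and> 3 \<le> l \<and> l \<le> n - 1} \<union>
     {X m (m+1) * X 1 n - X 1 n * X m (m+1) | m. 2 \<le> m \<and> m \<le> n - 2}"

definition rel_ideal :: "nat \<Rightarrow> 'a::field nc_poly set" where
  "rel_ideal n = genideal (free_algebra n) (relations n)"

definition residue_class :: "nat \<Rightarrow> 'a::field nc_poly \<Rightarrow> 'a nc_poly set" where
  "residue_class n p = rel_ideal n +>\<^bsub>free_algebra n\<^esub> p"

text \<open>
  The record type \<^typ>\<open>('a, 'b) module\<close> carries a ring multiplication besides the scalar
  multiplication, so it holds the full structure of an associative algebra.
\<close>

definition FK_cycle :: "nat \<Rightarrow> ('a::field, 'a nc_poly set) module" where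
  "FK_cycle n = (let Q = free_algebra n Quot rel_ideal n in
     \<lparr>carrier = carrier Q, mult = mult Q, one = one Q, zero = zero Q, add = add Q,
      smult = (\<lambda>c C. residue_class n (scalar c) \<otimes>\<^bsub>Q\<^esub> C)\<rparr>)"

definition FK_cycle_deg :: "nat \<Rightarrow> nat \<Rightarrow> 'a::field nc_poly set set" where
  "FK_cycle_deg n d = residue_class n `
     {p \<in> carrier (free_algebra n). \<forall>w \<in> Poly_Mapping.keys p. length w = d}"


section \<open>The action of symmetries of the cycle\<close>

text \<open>
  \<open>nc_subst \<sigma>\<close> is the algebra endomorphism with $x_{ij} \mapsto x_{\sigma(i)\sigma(j)}$.
\<close>

definition nc_subst :: "(nat \<Rightarrow> nat) \<Rightarrow> 'a::field nc_poly \<Rightarrow> 'a nc_poly" where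
  "nc_subst \<sigma> p =
     (\<Sum>w \<in> Poly_Mapping.keys p.
        scalar (Poly_Mapping.lookup p w) * prod_list (map (\<lambda>(i, j). X (\<sigma> i) (\<sigma> j)) w))"

text \<open>
  The union is over representatives of one residue class; when \<open>\<sigma>\<close> is a symmetry of the cycle,
  all of them contribute the same class.
\<close>

definition FK_action :: "nat \<Rightarrow> (nat \<Rightarrow> nat) \<Rightarrow> 'a::field nc_poly set \<Rightarrow> 'a nc_poly set" where
  "FK_action n \<sigma> C = (\<Union>p \<in> C. residue_class n (nc_subst \<sigma> p))"

text \<open>The reflection $s = (1\;n)(2\;n-1)\cdots$.\<close>

definition cycle_reflection :: "nat \<Rightarrow> nat \<Rightarrow> nat" where
  "cycle_reflection n i = (if 1 \<le> i \<and> i \<le> n then n + 1 - i else i)"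


section \<open>Traces and q-Fibonacci polynomials\<close>

text \<open>
  The coefficients of \<open>v\<close> in a basis \<open>B\<close> are unique on \<open>B\<close>, and the trace of an endomorphism
  of a finite-dimensional space does not depend on the basis, so the two choices below are
  immaterial.
\<close>

definition coordinate ::
  "('a::field, 'v, 'm) module_scheme \<Rightarrow> 'v set \<Rightarrow> 'v \<Rightarrow> 'v \<Rightarrow> 'a" where
  "coordinate V B v = (SOME a. module.lincomb V a B = v)"

definition lin_trace :: "('a::field, 'v, 'm) module_scheme \<Rightarrow> ('v \<Rightarrow> 'v) \<Rightarrow> 'a" where
  "lin_trace V T =
     (let B = (SOME B. finite B \<and> vectorspace.basis class_ring V B)
      in \<Sum>b\<in>B. coordinate V B (T b) b)"

definition graded_trace :: "nat \<Rightarrow> (nat \<Rightarrow> nat) \<Rightarrow> 'a::field fps" where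
  "graded_trace n \<sigma> =
     Abs_fps (\<lambda>d. lin_trace (FK_cycle n\<lparr>carrier := FK_cycle_deg n d\<rparr>) (FK_action n \<sigma>))"

definition q_fib :: "nat \<Rightarrow> 'b::comm_semiring_1 \<Rightarrow> 'b" where
  "q_fib m q = (\<Sum>k = 0..m div 2. of_nat ((m - k) choose k) * q ^ k)"

end

theory Submission
  imports Defs
begin

text \<open>
  In the quotient, two incident edges of the cycle (equal ones included) have product zero and any
  two other edges commute.  Hence a word either vanishes or depends only on its set of letters,
  which is a matching of the cycle, and the matchings give a basis of the algebra.  Their
  independence is seen from the linear forms that sum the coefficients of all words with a given
  matching as letter set: by a convolution formula their common kernel is an ideal, and it
  contains the relations (\<open>rel_ideal_iff_coeff\<close>).

  The reflection $s$ sends $x_{m,m+1}$ to $-x_{n-m,n-m+1}$ and $x_{1n}$ to $-x_{1n}$.  It permutes the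
  matching monomials up to the sign $(-1)^{\text{degree}}$, so its graded trace is
  $\sum_M (-q)^{|M|}$ over the invariant matchings $M$ (\<open>graded_trace_reflection\<close>).

  Let $n = 2h$ and number the edges cyclically from $0$ for $\overline{1n}$, so that $s$ acts by
  $k \mapsto -k$ modulo $n$.  It fixes the edges $0$ and $h$ and pairs the others, and an invariant
  matching is the same as a choice of pairwise nonconsecutive numbers in $0, \dots, h$.  The two ends of
  this path have weight $-q$, and an inner vertex, standing for two edges, has weight $q^2$.
  Sets of nonconsecutive vertices on a path are counted by the Fibonacci recurrence.  Here
  $F_h(q^2)$ accounts for the sets with neither end, $-q\,F_{h-1}(q^2)$ for those with one given end and
  $q^2 F_{h-2}(q^2)$ for those with both (\<open>sum_symmetric_matchings\<close>).

  The trace in the definition refers to an arbitrary finite basis; \<open>lin_trace_eq_resolution\<close> allows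
  it to be computed in the basis of matchings.
\<close>

section \<open>Traces from resolutions of the identity\<close>

definition linear_form :: "('a::field, 'v, 'm) module_scheme \<Rightarrow> ('v \<Rightarrow> 'a) \<Rightarrow> bool" where
  "linear_form V f \<longleftrightarrow>
     (\<forall>v\<in>carrier V. \<forall>w\<in>carrier V. f (v \<oplus>\<^bsub>V\<^esub> w) = f v + f w) \<and>
     (\<forall>c. \<forall>v\<in>carrier V. f (c \<odot>\<^bsub>V\<^esub> v) = c * f v)"

definition linear_endo :: "('a::field, 'v, 'm) module_scheme \<Rightarrow> ('v \<Rightarrow> 'v) \<Rightarrow> bool" where
  "linear_endo V T \<longleftrightarrow> T \<in> carrier V \<rightarrow> carrier V \<and>
     (\<forall>v\<in>carrier V. \<forall>w\<in>carrier V. T (v \<oplus>\<^bsub>V\<^esub> w) = T v \<oplus>\<^bsub>V\<^esub> T w) \<and>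
     (\<forall>c. \<forall>v\<in>carrier V. T (c \<odot>\<^bsub>V\<^esub> v) = c \<odot>\<^bsub>V\<^esub> T v)"

text \<open>
  A tensor $\sum_{i \in I} e_i \otimes c_i$ in $V \otimes V^*$ that represents the identity of $V$.
  Asking for this rather than for a basis with its dual basis is enough to compute traces, and
  leaves no linear independence to be checked.
\<close>

definition identity_resolution ::
  "('a::field, 'v, 'm) module_scheme \<Rightarrow> 'i set \<Rightarrow> ('i \<Rightarrow> 'v) \<Rightarrow> ('i \<Rightarrow> 'v \<Rightarrow> 'a) \<Rightarrow> bool" where
  "identity_resolution V I e c \<longleftrightarrow>
     finite I \<and> e \<in> I \<rightarrow> carrier V \<and> (\<forall>i\<in>I. linear_form V (c i)) \<and>
     (\<forall>v\<in>carrier V. v = finsum V (\<lambda>i. c i v \<odot>\<^bsub>V\<^esub> e i) I)"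

context
  fixes V :: "('a::field, 'v, 'm) module_scheme"
  assumes V: "vectorspace class_ring V"
begin

interpretation vectorspace class_ring V by (rule V)

lemma linear_form_zero:
  assumes "linear_form V f" shows "f \<zero>\<^bsub>V\<^esub> = 0"
proof -
  have "f (0 \<odot>\<^bsub>V\<^esub> \<zero>\<^bsub>V\<^esub>) = 0 * f \<zero>\<^bsub>V\<^esub>"
    using assms unfolding linear_form_def by blast
  moreover have "0 \<odot>\<^bsub>V\<^esub> \<zero>\<^bsub>V\<^esub> = \<zero>\<^bsub>V\<^esub>" using smult_r_null[of 0] by simp
  ultimately show ?thesis by simp
qed

lemma linear_endo_zero:
  assumes "linear_endo V T" shows "T \<zero>\<^bsub>V\<^esub> = \<zero>\<^bsub>V\<^esub>"
proof -
  have "T (0 \<odot>\<^bsub>V\<^esub> \<zero>\<^bsub>V\<^esub>) = 0 \<odot>\<^bsub>V\<^esub> T \<zero>\<^bsub>V\<^esub>" "T \<zero>\<^bsub>V\<^esub> \<in> carrier V"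
    using assms M.zero_closed unfolding linear_endo_def by blast+
  moreover have "0 \<odot>\<^bsub>V\<^esub> \<zero>\<^bsub>V\<^esub> = \<zero>\<^bsub>V\<^esub>" using smult_r_null[of 0] by simp
  moreover have "0 \<odot>\<^bsub>V\<^esub> v = \<zero>\<^bsub>V\<^esub>" if "v \<in> carrier V" for v using smult_l_null[of v] that by simp
  ultimately show ?thesis by simp
qed

lemma linear_form_finsum:
  assumes f: "linear_form V f" and I: "finite I" and g: "g \<in> I \<rightarrow> carrier V"
  shows "f (finsum V (\<lambda>i. a i \<odot>\<^bsub>V\<^esub> g i) I) = (\<Sum>i\<in>I. a i * f (g i))"
  using I g
proof (induction rule: finite_induct)
  case empty
  show ?case using linear_form_zero[OF f] by simp
next
  case (insert i I)
  have c: "(\<lambda>i. a i \<odot>\<^bsub>V\<^esub> g i) \<in> I \<rightarrow> carrier V" "a i \<odot>\<^bsub>V\<^esub> g i \<in> carrier V" "g i \<in> carrier V"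
    using insert.prems by auto
  then have "f (finsum V (\<lambda>i. a i \<odot>\<^bsub>V\<^esub> g i) (insert i I))
      = f (a i \<odot>\<^bsub>V\<^esub> g i \<oplus>\<^bsub>V\<^esub> finsum V (\<lambda>i. a i \<odot>\<^bsub>V\<^esub> g i) I)"
    using insert.hyps by (simp add: finsum_insert)
  also have "\<dots> = a i * f (g i) + f (finsum V (\<lambda>i. a i \<odot>\<^bsub>V\<^esub> g i) I)"
    using f c finsum_closed[OF c(1)] unfolding linear_form_def by simp
  finally show ?case using insert by simp
qed

lemma linear_endo_finsum:
  assumes T: "linear_endo V T" and I: "finite I" and g: "g \<in> I \<rightarrow> carrier V"
  shows "T (finsum V (\<lambda>i. a i \<odot>\<^bsub>V\<^esub> g i) I) = finsum V (\<lambda>i. a i \<odot>\<^bsub>V\<^esub> T (g i)) I"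
  using I g
proof (induction rule: finite_induct)
  case empty
  show ?case using linear_endo_zero[OF T] by simp
next
  case (insert i I)
  have Tg: "T v \<in> carrier V" if "v \<in> carrier V" for v
    using T that unfolding linear_endo_def by auto
  have c: "(\<lambda>i. a i \<odot>\<^bsub>V\<^esub> g i) \<in> I \<rightarrow> carrier V" "a i \<odot>\<^bsub>V\<^esub> g i \<in> carrier V" "g i \<in> carrier V"
    "(\<lambda>i. a i \<odot>\<^bsub>V\<^esub> T (g i)) \<in> I \<rightarrow> carrier V" "a i \<odot>\<^bsub>V\<^esub> T (g i) \<in> carrier V"
    using insert.prems Tg by (auto simp: Pi_iff)
  then have "T (finsum V (\<lambda>i. a i \<odot>\<^bsub>V\<^esub> g i) (insert i I))
      = T (a i \<odot>\<^bsub>V\<^esub> g i \<oplus>\<^bsub>V\<^esub> finsum V (\<lambda>i. a i \<odot>\<^bsub>V\<^esub> g i) I)"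
    using insert.hyps by (simp add: finsum_insert)
  also have "\<dots> = a i \<odot>\<^bsub>V\<^esub> T (g i) \<oplus>\<^bsub>V\<^esub> T (finsum V (\<lambda>i. a i \<odot>\<^bsub>V\<^esub> g i) I)"
    using T c finsum_closed[OF c(1)] unfolding linear_endo_def by simp
  finally show ?case using insert c by (simp add: finsum_insert)
qed

text \<open>
  Expanding each $e_i$ in the second resolution and interchanging the two sums gives
  $\sum_i c_i(T e_i) = \sum_{i,j} d_j(e_i)\, c_i(T f_j) = \sum_j d_j\big(\sum_i c_i(T f_j)\, e_i\big)$,
  and the inner sum on the right is the expansion of $T f_j$ in the first one.
\<close>

lemma trace_of_resolutions_eq:
  assumes e: "identity_resolution V I e c" and f: "identity_resolution V J f d"
    and T: "linear_endo V T"
  shows "(\<Sum>i\<in>I. c i (T (e i))) = (\<Sum>j\<in>J. d j (T (f j)))"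
proof -
  have fin: "finite I" "finite J" and ec: "e \<in> I \<rightarrow> carrier V" and fc: "f \<in> J \<rightarrow> carrier V"
    and c: "\<And>i. i \<in> I \<Longrightarrow> linear_form V (c i)" and d: "\<And>j. j \<in> J \<Longrightarrow> linear_form V (d j)"
    and ev: "\<And>v. v \<in> carrier V \<Longrightarrow> finsum V (\<lambda>i. c i v \<odot>\<^bsub>V\<^esub> e i) I = v"
    and fv: "\<And>v. v \<in> carrier V \<Longrightarrow> finsum V (\<lambda>j. d j v \<odot>\<^bsub>V\<^esub> f j) J = v"
    using e f unfolding identity_resolution_def by auto
  have Tc: "T v \<in> carrier V" if "v \<in> carrier V" for v
    using T that unfolding linear_endo_def by auto
  have Tf: "(\<lambda>j. T (f j)) \<in> J \<rightarrow> carrier V" using fc Tc by auto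
  have "c i (T (e i)) = (\<Sum>j\<in>J. d j (e i) * c i (T (f j)))" if i: "i \<in> I" for i
  proof -
    have ei: "e i \<in> carrier V" using ec i by auto
    have "c i (T (e i)) = c i (T (finsum V (\<lambda>j. d j (e i) \<odot>\<^bsub>V\<^esub> f j) J))"
      using fv[OF ei] by simp
    also have "\<dots> = (\<Sum>j\<in>J. d j (e i) * c i (T (f j)))"
      using linear_endo_finsum[OF T fin(2) fc] linear_form_finsum[OF c[OF i] fin(2) Tf] by simp
    finally show ?thesis .
  qed
  then have "(\<Sum>i\<in>I. c i (T (e i))) = (\<Sum>i\<in>I. \<Sum>j\<in>J. d j (e i) * c i (T (f j)))" by simp
  also have "\<dots> = (\<Sum>j\<in>J. \<Sum>i\<in>I. c i (T (f j)) * d j (e i))"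
    by (subst sum.swap) (simp add: mult.commute)
  also have "\<dots> = (\<Sum>j\<in>J. d j (T (f j)))"
  proof (rule sum.cong[OF refl])
    fix j assume j: "j \<in> J"
    then have "T (f j) \<in> carrier V" using Tf by auto
    then have "d j (T (f j)) = d j (finsum V (\<lambda>i. c i (T (f j)) \<odot>\<^bsub>V\<^esub> e i) I)" using ev by simp
    also have "\<dots> = (\<Sum>i\<in>I. c i (T (f j)) * d j (e i))"
      using linear_form_finsum[OF d[OF j] fin(1) ec] by simp
    finally show "(\<Sum>i\<in>I. c i (T (f j)) * d j (e i)) = d j (T (f j))" by simp
  qed
  finally show ?thesis .
qed

lemma lincomb_coordinate:
  assumes B: "finite B" "basis B" and v: "v \<in> carrier V"
  shows "lincomb (coordinate V B v) B = v"
proof -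
  have "v \<in> span B" "B \<subseteq> carrier V" using B v unfolding basis_def by auto
  then obtain a where "lincomb a B = v" using finite_in_span[OF B(1)] by blast
  then show ?thesis unfolding coordinate_def by (rule someI[of "\<lambda>a. lincomb a B = v"])
qed

lemma lincomb_unique:
  assumes B: "finite B" "basis B" and eq: "lincomb a B = lincomb b B" and x: "x \<in> B"
  shows "a x = b x"
proof (rule ccontr)
  assume ne: "a x \<noteq> b x"
  have BV: "B \<subseteq> carrier V" using B unfolding basis_def by auto
  have "lincomb (\<lambda>v. a v - b v) B = lincomb a B \<ominus>\<^bsub>V\<^esub> lincomb b B"
    using lincomb_diff[OF B(1) BV, of a b] by (simp add: class_ring_simps)
  also have "\<dots> = \<zero>\<^bsub>V\<^esub>"
    using eq lincomb_closed[OF BV, of b] by (simp add: a_minus_def M.r_neg)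
  finally have "lin_dep B"
    using B(1) x ne unfolding lin_dep_def by (intro exI[of _ B] exI[of _ "\<lambda>v. a v - b v"] exI[of _ x]) auto
  then show False using B unfolding basis_def by blast
qed

lemma basis_identity_resolution:
  assumes B: "finite B" "basis B"
  shows "identity_resolution V B (\<lambda>b. b) (\<lambda>b v. coordinate V B v b)"
proof -
  have BV: "B \<subseteq> carrier V" using B unfolding basis_def by auto
  have "linear_form V (\<lambda>v. coordinate V B v b)" if b: "b \<in> B" for b
    unfolding linear_form_def
  proof (intro conjI ballI allI)
    fix v w assume vw: "v \<in> carrier V" "w \<in> carrier V"
    have "lincomb (\<lambda>x. coordinate V B v x + coordinate V B w x) B = v \<oplus>\<^bsub>V\<^esub> w"
      using lincomb_sum[OF B(1) BV, of "coordinate V B v" "coordinate V B w"]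
        lincomb_coordinate[OF B] vw by simp
    also have "\<dots> = lincomb (coordinate V B (v \<oplus>\<^bsub>V\<^esub> w)) B"
      using lincomb_coordinate[OF B] vw by simp
    finally show "coordinate V B (v \<oplus>\<^bsub>V\<^esub> w) b = coordinate V B v b + coordinate V B w b"
      using lincomb_unique[OF B _ b] by metis
  next
    fix k v assume v: "v \<in> carrier V"
    have kv: "k \<odot>\<^bsub>V\<^esub> v \<in> carrier V" using v by simp
    have "lincomb (\<lambda>x. k * coordinate V B v x) B = k \<odot>\<^bsub>V\<^esub> v"
      using lincomb_smult[OF BV, of "coordinate V B v" k] lincomb_coordinate[OF B v] by simp
    also have "\<dots> = lincomb (coordinate V B (k \<odot>\<^bsub>V\<^esub> v)) B"
      using lincomb_coordinate[OF B kv] by simp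
    finally show "coordinate V B (k \<odot>\<^bsub>V\<^esub> v) b = k * coordinate V B v b"
      using lincomb_unique[OF B _ b] by metis
  qed
  then show ?thesis
    using B(1) BV lincomb_coordinate[OF B] unfolding identity_resolution_def lincomb_def by auto
qed

text \<open>
  The vectors of a resolution generate, so a finite basis exists and the choice made in
  \<^const>\<open>lin_trace\<close> is a genuine finite basis.  That basis with its coordinate functions is a
  second resolution of the identity, so the two traces agree.
\<close>

lemma lin_trace_eq_resolution:
  assumes e: "identity_resolution V I e c" and T: "linear_endo V T"
  shows "lin_trace V T = (\<Sum>i\<in>I. c i (T (e i)))"
proof -
  have "fin_dim"
  proof -
    have eI: "finite (e ` I)" "e ` I \<subseteq> carrier V"
      using e unfolding identity_resolution_def by auto
    have "v \<in> span (e ` I)" if v: "v \<in> carrier V" for v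
    proof -
      have "finsum V (\<lambda>i. c i v \<odot>\<^bsub>V\<^esub> e i) I' \<in> span (e ` I)" if "finite I'" "I' \<subseteq> I" for I'
        using that
      proof (induction rule: finite_induct)
        case empty then show ?case using span_zero by simp
      next
        case (insert i I')
        have *: "e i \<in> span (e ` I)" using insert eI span_mem by blast
        have "c i v \<odot>\<^bsub>V\<^esub> e i \<in> span (e ` I)"
          using span_is_submodule[OF eI(2)] * unfolding LinearCombinations.submodule_def by simp
        moreover have "(\<lambda>i. c i v \<odot>\<^bsub>V\<^esub> e i) \<in> I' \<rightarrow> carrier V" "c i v \<odot>\<^bsub>V\<^esub> e i \<in> carrier V"
          using insert.prems eI(2) by (auto simp: Pi_iff image_subset_iff)
        ultimately show ?case using insert span_add1[OF eI(2)] by (simp add: finsum_insert)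
      qed
      from this[of I] show ?thesis using e v unfolding identity_resolution_def by auto
    qed
    then have "gen_set (e ` I)" using span_closed[OF eI(2)] by blast
    then show ?thesis using eI unfolding fin_dim_def by blast
  qed
  then have "\<exists>B. finite B \<and> basis B" by (rule finite_basis_exists)
  then have B: "finite (SOME B. finite B \<and> basis B)" "basis (SOME B. finite B \<and> basis B)"
    using someI_ex[of "\<lambda>B. finite B \<and> basis B"] by auto
  show ?thesis
    unfolding lin_trace_def Let_def
    by (rule trace_of_resolutions_eq[OF basis_identity_resolution[OF B] e T])
qed

end

section \<open>The free algebra and letter sets of words\<close>

text \<open>
  The letters of a nonzero monomial of the quotient are distinct and commute, so the monomial is
  determined by its set of letters.  This linear form reads off the coefficient of the monomial
  with letter set \<open>S\<close>; it is only meaningful on the quotient when \<open>S\<close> is a matching.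
\<close>

definition coeff :: "'l set \<Rightarrow> ('l list \<Rightarrow>\<^sub>0 'a::comm_ring_1) \<Rightarrow> 'a" where
  "coeff S p = (\<Sum>w\<in>Poly_Mapping.keys p. Poly_Mapping.lookup p w * of_bool (distinct w \<and> set w = S))"

lemma coeff_superset:
  assumes "finite A" "Poly_Mapping.keys p \<subseteq> A"
  shows "coeff S p = (\<Sum>w\<in>A. Poly_Mapping.lookup p w * of_bool (distinct w \<and> set w = S))"
  unfolding coeff_def
  by (rule sum.mono_neutral_left) (use assms in \<open>auto simp: in_keys_iff\<close>)

lemma coeff_add: "coeff S (p + q) = coeff S p + coeff S q"
proof -
  let ?A = "Poly_Mapping.keys p \<union> Poly_Mapping.keys q"
  have "finite ?A" "Poly_Mapping.keys (p + q) \<subseteq> ?A" by (simp_all add: Poly_Mapping.keys_add)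
  then show ?thesis
    by (simp add: coeff_superset[of ?A] lookup_add distrib_right sum.distrib)
qed

lemma coeff_zero [simp]: "coeff S 0 = 0"
  by (simp add: coeff_def)

lemma coeff_uminus: "coeff S (- p) = - coeff S p"
  using coeff_add[of S p "- p"] by (simp add: eq_neg_iff_add_eq_0 add.commute)

lemma coeff_diff: "coeff S (p - q) = coeff S p - coeff S q"
  using coeff_add[of S p "- q"] by (simp add: coeff_uminus)

lemma coeff_sum: "coeff S (\<Sum>i\<in>I. f i) = (\<Sum>i\<in>I. coeff S (f i))"
  by (induction I rule: infinite_finite_induct) (simp_all add: coeff_add)

lemma coeff_single:
  "coeff S (Poly_Mapping.single w c) = c * of_bool (distinct w \<and> set w = S)"
  by (simp add: coeff_def)

lemma sum_single_lookup:
  "p = (\<Sum>w\<in>Poly_Mapping.keys p. Poly_Mapping.single w (Poly_Mapping.lookup p w))"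
  by (rule poly_mapping_eqI)
    (simp add: lookup_sum lookup_single when_def sum.delta' in_keys_iff)

text \<open>
  A word without repeated letters and with letter set \<open>S\<close> is cut by each factorization \<open>u @ w\<close> into
  words with complementary letter sets.  The formula makes the common kernel of the \<open>coeff S\<close>, for
  \<open>S\<close> in a family closed under subsets, a two-sided ideal.
\<close>

lemma coeff_mult:
  assumes "finite S"
  shows "coeff S (p * q) = (\<Sum>U\<in>Pow S. coeff U p * coeff (S - U) q)"
proof -
  let ?s = "Poly_Mapping.single" and ?K = Poly_Mapping.keys and ?l = Poly_Mapping.lookup
  let ?g = "\<lambda>S w. of_bool (distinct w \<and> set w = S) :: 'b"
  have split: "?g S (u @ w) = (\<Sum>U\<in>Pow S. ?g U u * ?g (S - U) w)" for u w :: "'a list"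
  proof -
    have "(\<Sum>U\<in>Pow S. ?g U u * ?g (S - U) w) =
          (\<Sum>U\<in>Pow S. if U = set u then of_bool (distinct u) * ?g (S - set u) w else 0)"
      by (rule sum.cong) auto
    also have "\<dots> = (if set u \<subseteq> S then of_bool (distinct u) * ?g (S - set u) w else 0)"
      using assms by (simp add: sum.delta)
    also have "\<dots> = ?g S (u @ w)" by auto
    finally show ?thesis ..
  qed
  have "p * q = (\<Sum>u\<in>?K p. ?s u (?l p u)) * (\<Sum>w\<in>?K q. ?s w (?l q w))"
    using sum_single_lookup[of p] sum_single_lookup[of q] by simp
  also have "\<dots> = (\<Sum>u\<in>?K p. \<Sum>w\<in>?K q. ?s (u @ w) (?l p u * ?l q w))"
    by (simp add: sum_product mult_single plus_list_def)
  finally have "coeff S (p * q) = (\<Sum>u\<in>?K p. \<Sum>w\<in>?K q. ?l p u * ?l q w * ?g S (u @ w))"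
    by (simp add: coeff_sum coeff_single)
  also have "\<dots> = (\<Sum>u\<in>?K p. \<Sum>w\<in>?K q. \<Sum>U\<in>Pow S. (?l p u * ?g U u) * (?l q w * ?g (S - U) w))"
    unfolding split sum_distrib_left by (intro sum.cong refl) (simp add: ac_simps)
  also have "\<dots> = (\<Sum>u\<in>?K p. \<Sum>U\<in>Pow S. \<Sum>w\<in>?K q. (?l p u * ?g U u) * (?l q w * ?g (S - U) w))"
    by (intro sum.cong refl sum.swap)
  also have "\<dots> = (\<Sum>U\<in>Pow S. \<Sum>u\<in>?K p. \<Sum>w\<in>?K q. (?l p u * ?g U u) * (?l q w * ?g (S - U) w))"
    by (rule sum.swap)
  also have "\<dots> = (\<Sum>U\<in>Pow S. coeff U p * coeff (S - U) q)"
    unfolding coeff_def sum_product ..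
  finally show ?thesis .
qed

lemma free_algebra_simps [simp]:
  "p \<in> carrier (free_algebra n) \<longleftrightarrow> Poly_Mapping.keys p \<subseteq> lists (cycle_edges n)"
  "p \<otimes>\<^bsub>free_algebra n\<^esub> q = p * q" "p \<oplus>\<^bsub>free_algebra n\<^esub> q = p + q"
  "\<one>\<^bsub>free_algebra n\<^esub> = 1" "\<zero>\<^bsub>free_algebra n\<^esub> = 0"
  by (simp_all add: free_algebra_def)

lemma one_nc_poly: "(1 :: 'l list \<Rightarrow>\<^sub>0 'a::field) = Poly_Mapping.single [] 1"
  by (simp flip: single_one add: zero_list_def)

lemma carrier_closed:
  assumes "Poly_Mapping.keys p \<subseteq> lists E" "Poly_Mapping.keys q \<subseteq> lists E"
  shows "Poly_Mapping.keys (p * q) \<subseteq> lists E" "Poly_Mapping.keys (p + q) \<subseteq> lists E"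
    "Poly_Mapping.keys (p - q) \<subseteq> lists E"
proof -
  show "Poly_Mapping.keys (p + q) \<subseteq> lists E"
    using assms Poly_Mapping.keys_add[of p q] by blast
  have "Poly_Mapping.keys (p - q) \<subseteq> Poly_Mapping.keys p \<union> Poly_Mapping.keys q"
    by (auto simp: in_keys_iff lookup_minus)
  then show "Poly_Mapping.keys (p - q) \<subseteq> lists E" using assms by blast
  show "Poly_Mapping.keys (p * q) \<subseteq> lists E"
    using assms keys_mult[of p q] by (fastforce simp: plus_list_def)
qed

lemma carrier_sum:
  fixes f :: "'i \<Rightarrow> 'l list \<Rightarrow>\<^sub>0 'a::field"
  assumes "\<And>i. i \<in> I \<Longrightarrow> Poly_Mapping.keys (f i) \<subseteq> lists E"
  shows "Poly_Mapping.keys (\<Sum>i\<in>I. f i) \<subseteq> lists E"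
  using assms
proof (induction I rule: infinite_finite_induct)
  case (insert i I)
  have "Poly_Mapping.keys (f i) \<subseteq> lists E" "Poly_Mapping.keys (\<Sum>i\<in>I. f i) \<subseteq> lists E"
    using insert by blast+
  from carrier_closed(2)[OF this] show ?case using insert.hyps by simp
qed simp_all

lemma keys_uminus_eq [simp]: "Poly_Mapping.keys (- p) = Poly_Mapping.keys (p :: _ \<Rightarrow>\<^sub>0 'a::ab_group_add)"
  by (auto simp: in_keys_iff)

lemma ring_free_algebra: "ring (free_algebra n)"
proof (rule ringI)
  show "abelian_group (free_algebra n :: 'a::field nc_poly ring)"
  proof (rule abelian_groupI)
    fix x :: "'a nc_poly" assume "x \<in> carrier (free_algebra n)"
    then show "\<exists>y\<in>carrier (free_algebra n). y \<oplus>\<^bsub>free_algebra n\<^esub> x = \<zero>\<^bsub>free_algebra n\<^esub>"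
      by (intro bexI[of _ "- x"]) auto
  qed (simp_all add: carrier_closed ac_simps)
  show "monoid (free_algebra n :: 'a::field nc_poly ring)"
    by (rule monoidI) (simp_all add: carrier_closed mult.assoc zero_list_def)
qed (simp_all add: distrib_left distrib_right)

section \<open>Matchings of the cycle and the defining relations\<close>

definition incident :: "nat \<times> nat \<Rightarrow> nat \<times> nat \<Rightarrow> bool" where
  "incident e f \<longleftrightarrow> {fst e, snd e} \<inter> {fst f, snd f} \<noteq> {}"

definition matching :: "nat \<Rightarrow> (nat \<times> nat) set \<Rightarrow> bool" where
  "matching n S \<longleftrightarrow> S \<subseteq> cycle_edges n \<and> (\<forall>e\<in>S. \<forall>f\<in>S. e \<noteq> f \<longrightarrow> \<not> incident e f)"

lemma incident_sym: "incident e f \<longleftrightarrow> incident f e"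
  by (auto simp: incident_def)

lemma incident_refl [simp]: "incident e e"
  by (auto simp: incident_def)

lemma finite_cycle_edges [simp]: "finite (cycle_edges n)"
proof -
  have "cycle_edges n \<subseteq> {..n+1} \<times> {..n+1}" by (auto simp: cycle_edges_def)
  then show ?thesis by (rule finite_subset) auto
qed

lemma matching_finite: "matching n S \<Longrightarrow> finite S"
  unfolding matching_def using finite_subset finite_cycle_edges by blast

lemma matching_subset: "matching n S \<Longrightarrow> U \<subseteq> S \<Longrightarrow> matching n U"
  unfolding matching_def by blast

lemma X_less: "i < j \<Longrightarrow> X i j = Poly_Mapping.single [(i, j)] 1"
  by (simp add: X_def)

lemma single_letter_mult [simp]:
  "Poly_Mapping.single [e] (1::'a::field) * Poly_Mapping.single [f] 1 = Poly_Mapping.single [e, f] 1"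
  by (simp add: mult_single plus_list_def)

text \<open>
  The defining relations treat the edge \<open>(1, n)\<close> separately.  The next three lemmas replace their
  list by one rule: products of two incident (possibly equal) edges vanish, and other edges commute.
\<close>

lemma incident_cycle_edges:
  assumes n: "n \<ge> 4" and e: "e \<in> cycle_edges n" and f: "f \<in> cycle_edges n" and i: "incident e f"
  shows "Poly_Mapping.single [e, f] 1 \<in> relations n"
proof -
  obtain i j k l where ef: "e = (i, j)" "f = (k, l)" by (metis surj_pair)
  have ij: "1 \<le> i \<and> i \<le> n - 1 \<and> j = i + 1 \<or> i = 1 \<and> j = n"
    and kl: "1 \<le> k \<and> k \<le> n - 1 \<and> l = k + 1 \<or> k = 1 \<and> l = n"
    using e f ef by (auto simp: cycle_edges_def)
  then have lt: "i < j" "k < l" using n by auto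
  have meet: "i = k \<or> i = l \<or> j = k \<or> j = l" using i ef by (auto simp: incident_def)
  have "X i j * X k l \<in> (relations n :: 'a::field nc_poly set)"
    using ij
  proof (elim disjE conjE)
    assume i: "1 \<le> i" "i \<le> n - 1" "j = i + 1"
    show ?thesis using kl
    proof (elim disjE conjE)
      assume k: "1 \<le> k" "k \<le> n - 1" "l = k + 1"
      then consider "k = i" | "k = i + 1" | "i = k + 1" using meet i by force
      then show ?thesis
      proof cases
        case 1
        then show ?thesis using i k unfolding relations_def by blast
      next
        case 2
        then have "i \<le> n - 2" "l = i + 2" using k by simp_all
        then show ?thesis using 2 i unfolding relations_def by blast
      next
        case 3
        then have "k \<le> n - 2" "j = k + 2" using i by simp_all
        then show ?thesis using 3 k unfolding relations_def by blast
      qed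
    next
      assume k: "k = 1" "l = n"
      then consider "i = 1" "j = 2" | "i = n - 1" "j = n" using meet i n by force
      then show ?thesis using k unfolding relations_def by cases blast+
    qed
  next
    assume i: "i = 1" "j = n"
    show ?thesis using kl
    proof (elim disjE conjE)
      assume k: "1 \<le> k" "k \<le> n - 1" "l = k + 1"
      then consider "k = 1" "l = 2" | "k = n - 1" "l = n" using meet i n by force
      then show ?thesis using i unfolding relations_def by cases blast+
    next
      assume "k = 1" "l = n"
      then show ?thesis using i unfolding relations_def by blast
    qed
  qed
  then show ?thesis using lt ef by (simp add: X_less)
qed

lemma not_incident_cycle_edges:
  assumes n: "n \<ge> 4" and e: "e \<in> cycle_edges n" and f: "f \<in> cycle_edges n" and i: "\<not> incident e f"
  shows "Poly_Mapping.single [e, f] 1 - Poly_Mapping.single [f, e] 1 \<in> relations n \<or>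
         Poly_Mapping.single [f, e] 1 - Poly_Mapping.single [e, f] 1 \<in> (relations n :: 'a::field nc_poly set)"
proof -
  obtain i j k l where ef: "e = (i, j)" "f = (k, l)" by (metis surj_pair)
  have ij: "1 \<le> i \<and> i \<le> n - 1 \<and> j = i + 1 \<or> i = 1 \<and> j = n"
    and kl: "1 \<le> k \<and> k \<le> n - 1 \<and> l = k + 1 \<or> k = 1 \<and> l = n"
    using e f ef by (auto simp: cycle_edges_def)
  then have lt: "i < j" "k < l" using n by auto
  have ne: "i \<noteq> k" "i \<noteq> l" "j \<noteq> k" "j \<noteq> l" using i ef by (auto simp: incident_def)
  have "X i j * X k l - X k l * X i j \<in> relations n \<or>
        X k l * X i j - X i j * X k l \<in> (relations n :: 'a::field nc_poly set)"
    using ij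
  proof (elim disjE conjE)
    assume i: "1 \<le> i" "i \<le> n - 1" "j = i + 1"
    show ?thesis using kl
    proof (elim disjE conjE)
      assume k: "1 \<le> k" "k \<le> n - 1" "l = k + 1"
      show ?thesis
      proof (cases "i < k")
        case True
        then have "i + 2 \<le> k" "3 \<le> k" using ne i by linarith+
        then show ?thesis using i k unfolding relations_def by blast
      next
        case False
        then have "k + 2 \<le> i" "3 \<le> i" using ne i k by linarith+
        then show ?thesis using i k unfolding relations_def by blast
      qed
    next
      assume k: "k = 1" "l = n"
      then have "2 \<le> i" "i \<le> n - 2" using ne i by linarith+
      then show ?thesis using i k unfolding relations_def by blast
    qed
  next
    assume i: "i = 1" "j = n"
    then have k: "1 \<le> k" "k \<le> n - 1" "l = k + 1" using ne kl by auto
    then have "2 \<le> k" "k \<le> n - 2" using ne i by linarith+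
    then show ?thesis using i k unfolding relations_def by blast
  qed
  then show ?thesis using lt ef by (simp add: X_less)
qed

lemma relations_cases:
  assumes n: "n \<ge> 4" and p: "p \<in> (relations n :: 'a::field nc_poly set)"
  obtains e f where "e \<in> cycle_edges n" "f \<in> cycle_edges n" "incident e f" "p = Poly_Mapping.single [e, f] 1"
  | e f where "e \<in> cycle_edges n" "f \<in> cycle_edges n" "p = Poly_Mapping.single [e, f] 1 - Poly_Mapping.single [f, e] 1"
proof -
  have E: "1 \<le> m \<Longrightarrow> m \<le> n - 1 \<Longrightarrow> (m, m + 1) \<in> cycle_edges n"
    "1 \<le> m \<Longrightarrow> m \<le> n - 1 \<Longrightarrow> (m, Suc m) \<in> cycle_edges n"  "(1, n) \<in> cycle_edges n"
    "(Suc 0, n) \<in> cycle_edges n" for m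
    by (auto simp: cycle_edges_def)
  have E2: "1 \<le> m \<Longrightarrow> m \<le> n - 2 \<Longrightarrow> (m + 1, m + 2) \<in> cycle_edges n" for m
    using E(1)[of "m + 1"] n by simp
  have E3: "(n - 1, n) \<in> cycle_edges n" using E(1)[of "n - 1"] n by simp
  have E4: "(1, 2) \<in> cycle_edges n" using E(1)[of 1] n by (simp add: numeral_2_eq_2)
  have n1: "1 < n" "n - 1 < n" using n by auto
  note p' = p[unfolded relations_def Un_iff mem_Collect_eq insert_iff empty_iff]
  show thesis using p'
  proof (elim disjE exE conjE FalseE)
    fix m assume "p = X m (m + 1) * X m (m + 1)" "1 \<le> m" "m \<le> n - 1"
    then show thesis using E by (intro that(1)[of "(m, m+1)" "(m, m+1)"]) (auto simp: X_less)
  next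
    assume "p = X 1 n * X 1 n"
    then show thesis using E n1 by (intro that(1)[of "(1, n)" "(1, n)"]) (auto simp: X_less)
  next
    fix m assume "p = X m (m + 1) * X (m + 1) (m + 2)" "1 \<le> m" "m \<le> n - 2"
    then show thesis using E(1)[of m] E2
      by (intro that(1)[of "(m, m+1)" "(m+1, m+2)"]) (auto simp: X_less incident_def)
  next
    fix m assume "p = X (m + 1) (m + 2) * X m (m + 1)" "1 \<le> m" "m \<le> n - 2"
    then show thesis using E(1)[of m] E2
      by (intro that(1)[of "(m+1, m+2)" "(m, m+1)"]) (auto simp: X_less incident_def)
  next
    assume "p = X (n-1) n * X 1 n"
    then show thesis using E(3) E3 n1
      by (intro that(1)[of "(n-1, n)" "(1, n)"]) (auto simp: X_less incident_def)
  next
    assume "p = X 1 n * X (n-1) n"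
    then show thesis using E(3) E3 n1
      by (intro that(1)[of "(1, n)" "(n-1, n)"]) (auto simp: X_less incident_def)
  next
    assume "p = X 1 2 * X 1 n"
    then show thesis using E(3) E4 n1
      by (intro that(1)[of "(1, 2)" "(1, n)"]) (auto simp: X_less incident_def)
  next
    assume "p = X 1 n * X 1 2"
    then show thesis using E(3) E4 n1
      by (intro that(1)[of "(1, n)" "(1, 2)"]) (auto simp: X_less incident_def)
  next
    fix m l assume "p = X m (m + 1) * X l (l + 1) - X l (l + 1) * X m (m + 1)"
      "1 \<le> m" "m + 2 \<le> l" "3 \<le> l" "l \<le> n - 1"
    then show thesis using E(1)[of m] E(1)[of l]
      by (intro that(2)[of "(m, m+1)" "(l, l+1)"]) (auto simp: X_less)
  next
    fix m assume "p = X m (m + 1) * X 1 n - X 1 n * X m (m + 1)" "2 \<le> m" "m \<le> n - 2"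
    then show thesis using E(1)[of m] E(3) n1
      by (intro that(2)[of "(m, m+1)" "(1, n)"]) (auto simp: X_less)
  qed
qed

section \<open>Matching monomials span the quotient and are independent\<close>

lemma a_inv_free_algebra:
  assumes "p \<in> carrier (free_algebra n)"
  shows "\<ominus>\<^bsub>free_algebra n\<^esub> p = - p"
proof -
  interpret ring "free_algebra n" by (rule ring_free_algebra)
  show ?thesis using assms minus_equality[of "- p" p] by simp
qed

text \<open>
  The candidate for the ideal of relations.  It is closed under multiplication because a subset of
  a matching is a matching.
\<close>

lemma ideal_vanishing_coeff:
  "ideal {p \<in> carrier (free_algebra n). \<forall>S. matching n S \<longrightarrow> coeff S p = (0 :: 'a::field)} (free_algebra n)"
    (is "ideal ?J ?R")
proof (rule idealI[OF ring_free_algebra])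
  interpret ring ?R by (rule ring_free_algebra)
  show "subgroup ?J (add_monoid ?R)"
  proof (rule add.subgroupI)
    show "\<ominus>\<^bsub>?R\<^esub> p \<in> ?J" if "p \<in> ?J" for p
      using that a_inv_free_algebra[of p n] by (auto simp: coeff_uminus)
    show "p \<oplus>\<^bsub>?R\<^esub> q \<in> ?J" if "p \<in> ?J" "q \<in> ?J" for p q
      using that by (simp add: carrier_closed coeff_add)
    have "0 \<in> ?J" by simp
    then show "?J \<noteq> {}" by blast
  qed auto
next
  fix p q assume p: "p \<in> ?J" and q: "q \<in> carrier ?R"
  have "coeff S (q * p) = 0 \<and> coeff S (p * q) = 0" if S: "matching n S" for S
  proof -
    have "coeff U p = 0" "coeff (S - U) p = 0" if "U \<in> Pow S" for U
      using p matching_subset[OF S, of U] matching_subset[OF S, of "S - U"] that by auto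
    then show ?thesis by (simp add: coeff_mult[OF matching_finite[OF S]])
  qed
  then show "q \<otimes>\<^bsub>?R\<^esub> p \<in> ?J" "p \<otimes>\<^bsub>?R\<^esub> q \<in> ?J"
    using p q by (simp_all add: carrier_closed)
qed

context
  fixes n :: nat
  assumes n: "n \<ge> 4"
begin

lemma relations_carrier: "relations n \<subseteq> (carrier (free_algebra n) :: 'a::field nc_poly set)"
proof
  fix p :: "'a nc_poly" assume p: "p \<in> relations n"
  show "p \<in> carrier (free_algebra n)"
    by (cases rule: relations_cases[OF n p]) (simp_all add: carrier_closed(3))
qed

lemma coeff_rel_ideal:
  assumes "p \<in> (rel_ideal n :: 'a::field nc_poly set)" "matching n S"
  shows "coeff S p = 0"
proof -
  let ?J = "{p \<in> carrier (free_algebra n). \<forall>S. matching n S \<longrightarrow> coeff S p = (0 :: 'a)}"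
  have "relations n \<subseteq> ?J"
  proof
    fix p :: "'a nc_poly" assume p: "p \<in> relations n"
    have "coeff S p = 0" if "matching n S" for S
    proof (cases rule: relations_cases[OF n p])
      case (1 e f)
      then have "\<not> (distinct [e, f] \<and> set [e, f] = S)"
        using that unfolding matching_def by auto
      then show ?thesis using 1 by (simp add: coeff_single)
    next
      case (2 e f)
      then show ?thesis by (auto simp: coeff_diff coeff_single insert_commute)
    qed
    then show "p \<in> ?J" using p relations_carrier by blast
  qed
  then have "rel_ideal n \<subseteq> ?J"
    unfolding rel_ideal_def
    by (intro ring.genideal_minimal[OF ring_free_algebra ideal_vanishing_coeff])
  then show ?thesis using assms by blast
qed

lemma ideal_rel_ideal: "ideal (rel_ideal n :: 'a::field nc_poly set) (free_algebra n)"
  unfolding rel_ideal_def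
  by (rule ring.genideal_ideal[OF ring_free_algebra relations_carrier])

lemma relations_rel_ideal: "relations n \<subseteq> (rel_ideal n :: 'a::field nc_poly set)"
  unfolding rel_ideal_def
  by (rule ring.genideal_self[OF ring_free_algebra relations_carrier])

lemma rel_ideal_carrier: "p \<in> rel_ideal n \<Longrightarrow> Poly_Mapping.keys p \<subseteq> lists (cycle_edges n)"
  using ideal.Icarr[OF ideal_rel_ideal] by simp

lemma rel_ideal_zero: "0 \<in> rel_ideal n"
  using additive_subgroup.zero_closed[OF ideal.axioms(1)[OF ideal_rel_ideal]] by simp

lemma rel_ideal_add: "p \<in> rel_ideal n \<Longrightarrow> q \<in> rel_ideal n \<Longrightarrow> p + q \<in> rel_ideal n"
  using additive_subgroup.a_closed[OF ideal.axioms(1)[OF ideal_rel_ideal]] by simp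

lemma rel_ideal_mult:
  assumes "p \<in> rel_ideal n" "Poly_Mapping.keys q \<subseteq> lists (cycle_edges n)"
  shows "q * p \<in> rel_ideal n" "p * q \<in> rel_ideal n"
  using ideal.I_l_closed[OF ideal_rel_ideal] ideal.I_r_closed[OF ideal_rel_ideal] assms by simp_all

lemma rel_ideal_uminus: "p \<in> rel_ideal n \<Longrightarrow> - p \<in> rel_ideal n"
  using additive_subgroup.a_inv_closed[OF ideal.axioms(1)[OF ideal_rel_ideal], of p]
    a_inv_free_algebra[of p n] rel_ideal_carrier[of p] by simp

lemma rel_ideal_sum: "(\<And>i. i \<in> I \<Longrightarrow> f i \<in> rel_ideal n) \<Longrightarrow> (\<Sum>i\<in>I. f i) \<in> rel_ideal n"
  by (induction I rule: infinite_finite_induct) (auto intro: rel_ideal_add rel_ideal_zero)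

text \<open>
  Congruence and vanishing of words in the quotient.  The type argument fixes the coefficient
  field, which cannot be read off from the words.
\<close>

definition word_cong :: "'a::field itself \<Rightarrow> (nat \<times> nat) list \<Rightarrow> (nat \<times> nat) list \<Rightarrow> bool" where
  "word_cong _ u w \<longleftrightarrow> Poly_Mapping.single u 1 - Poly_Mapping.single w 1 \<in> (rel_ideal n :: 'a nc_poly set)"

definition word_null :: "'a::field itself \<Rightarrow> (nat \<times> nat) list \<Rightarrow> bool" where
  "word_null _ u \<longleftrightarrow> Poly_Mapping.single u 1 \<in> (rel_ideal n :: 'a nc_poly set)"

lemma word_cong_refl: "word_cong F u u"
  by (simp add: word_cong_def rel_ideal_zero)

lemma word_cong_sym: "word_cong F u w \<Longrightarrow> word_cong F w u"
  unfolding word_cong_def by (drule rel_ideal_uminus) simp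

lemma word_cong_trans: "word_cong F u v \<Longrightarrow> word_cong F v w \<Longrightarrow> word_cong F u w"
  unfolding word_cong_def by (drule (1) rel_ideal_add) simp

lemma word_null_cong: "word_cong F u w \<Longrightarrow> word_null F w \<Longrightarrow> word_null F u"
  unfolding word_cong_def word_null_def by (drule (1) rel_ideal_add) simp

lemma word_cong_append:
  assumes "word_cong F u w" "set x \<subseteq> cycle_edges n" "set y \<subseteq> cycle_edges n"
  shows "word_cong F (x @ u @ y) (x @ w @ y)"
proof -
  have "Poly_Mapping.single x 1 * (Poly_Mapping.single u 1 - Poly_Mapping.single w 1)
      * Poly_Mapping.single y 1 \<in> (rel_ideal n :: 'a nc_poly set)"
    using assms unfolding word_cong_def by (intro rel_ideal_mult) auto
  then show ?thesis
    by (simp add: word_cong_def right_diff_distrib left_diff_distrib mult_single plus_list_def)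
qed

lemma word_null_append:
  assumes "word_null F u" "set x \<subseteq> cycle_edges n" "set y \<subseteq> cycle_edges n"
  shows "word_null F (x @ u @ y)"
proof -
  have "Poly_Mapping.single x 1 * Poly_Mapping.single u 1 * Poly_Mapping.single y 1
      \<in> (rel_ideal n :: 'a nc_poly set)"
    using assms unfolding word_null_def by (intro rel_ideal_mult) auto
  then show ?thesis by (simp add: word_null_def mult_single plus_list_def)
qed

lemma word_null_incident:
  assumes "e \<in> cycle_edges n" "f \<in> cycle_edges n" "incident e f"
  shows "word_null F [e, f]"
  unfolding word_null_def
  using incident_cycle_edges[OF n assms] relations_rel_ideal by blast

lemma word_cong_swap:
  assumes "e \<in> cycle_edges n" "f \<in> cycle_edges n" "\<not> incident e f"
  shows "word_cong F [e, f] [f, e]"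
proof -
  have "Poly_Mapping.single [e, f] 1 - Poly_Mapping.single [f, e] 1 \<in> (rel_ideal n :: 'a nc_poly set) \<or>
        Poly_Mapping.single [f, e] 1 - Poly_Mapping.single [e, f] 1 \<in> (rel_ideal n :: 'a nc_poly set)"
    using not_incident_cycle_edges[OF n assms] relations_rel_ideal by blast
  then show ?thesis
    using word_cong_sym[of F "[f, e]" "[e, f]"] by (auto simp: word_cong_def)
qed

lemma word_cong_move:
  assumes "e \<in> cycle_edges n" "set v \<subseteq> cycle_edges n" "set z \<subseteq> cycle_edges n"
    and "\<forall>f\<in>set v. \<not> incident e f"
  shows "word_cong F (e # v @ z) (v @ e # z)"
  using assms
proof (induction v)
  case (Cons f v)
  have "word_cong F ([] @ [e, f] @ (v @ z)) ([] @ [f, e] @ (v @ z))"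
    using Cons.prems by (intro word_cong_append word_cong_swap) auto
  moreover have "word_cong F ([f] @ (e # v @ z) @ []) ([f] @ (v @ e # z) @ [])"
    using Cons by (intro word_cong_append) auto
  ultimately show ?case by (auto intro: word_cong_trans)
qed (simp add: word_cong_refl)

text \<open>
  If the tail of the word is already good, move the first letter to the right, past letters that
  commute with it, until it stands next to the first letter that it is incident to.
\<close>

lemma word_null_if_not_matching:
  assumes "set w \<subseteq> cycle_edges n" "\<not> (distinct w \<and> matching n (set w))"
  shows "word_null F w"
  using assms
proof (induction w)
  case Nil
  then show ?case by (simp add: matching_def)
next
  case (Cons e w)
  show ?case
  proof (cases "distinct w \<and> matching n (set w)")
    case False
    then have "word_null F ([e] @ w @ [])"
      using Cons by (intro word_null_append) auto
    then show ?thesis by simp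
  next
    case True
    then have "\<exists>f\<in>set w. incident e f"
      using Cons.prems incident_sym unfolding matching_def by auto (metis incident_refl)
    then obtain u f v where w: "w = u @ f # v" "incident e f" "\<forall>g\<in>set u. \<not> incident e g"
      using split_list_first_propE by metis
    have "word_cong F (e # u @ f # v) (u @ e # f # v)"
      using Cons.prems w by (intro word_cong_move) auto
    moreover have "word_null F (u @ [e, f] @ v)"
      using Cons.prems w by (intro word_null_append word_null_incident) auto
    ultimately show ?thesis using w word_null_cong by auto
  qed
qed

text \<open>
  The letters of a matching commute pairwise, so the first letter of one word can be brought to the
  front of the other.
\<close>

lemma word_cong_if_same_matching:
  assumes "distinct u" "distinct w" "set u = set w" "matching n (set u)"
  shows "word_cong F u w"
  using assms
proof (induction u arbitrary: w)
  case Nil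
  then show ?case by (simp add: word_cong_refl)
next
  case (Cons e u)
  then obtain a b where w: "w = a @ e # b" by (metis list.set_intros(1) split_list)
  have E: "set (e # u) \<subseteq> cycle_edges n" "set w \<subseteq> cycle_edges n"
    using Cons.prems unfolding matching_def by auto
  have "set u = set (a @ b)" using Cons.prems w by auto
  moreover have "matching n (set u)" using Cons.prems(4) matching_subset by fastforce
  ultimately have "word_cong F u (a @ b)" using Cons w by auto
  then have "word_cong F ([e] @ u @ []) ([e] @ (a @ b) @ [])"
    using E by (intro word_cong_append) auto
  moreover have "word_cong F (e # a @ b) (a @ e # b)"
    using E w Cons.prems unfolding matching_def by (intro word_cong_move) auto
  ultimately show ?case using w by (auto intro: word_cong_trans)
qed

definition matching_word :: "(nat \<times> nat) set \<Rightarrow> (nat \<times> nat) list" where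
  "matching_word S = (SOME w. distinct w \<and> set w = S)"

lemma matching_word:
  assumes "matching n S"
  shows "distinct (matching_word S)" "set (matching_word S) = S"
proof -
  have "\<exists>w. distinct w \<and> set w = S" using finite_distinct_list matching_finite[OF assms] by blast
  from someI_ex[OF this] show "distinct (matching_word S)" "set (matching_word S) = S"
    unfolding matching_word_def by auto
qed

lemma coeff_matching_word:
  assumes "matching n U"
  shows "coeff S (Poly_Mapping.single (matching_word U) c) = c * of_bool (S = U)"
  using matching_word[OF assms] by (auto simp: coeff_single)

lemma finite_matchings [simp]: "finite {S. matching n S}"
  by (rule finite_subset[of _ "Pow (cycle_edges n)"]) (auto simp: matching_def)

text \<open>
  Modulo the relations each word either vanishes or equals the chosen word of its letter set.
\<close>

lemma normal_form:
  fixes p :: "'a::field nc_poly"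
  assumes p: "Poly_Mapping.keys p \<subseteq> lists (cycle_edges n)"
  shows "p - (\<Sum>S | matching n S. Poly_Mapping.single (matching_word S) (coeff S p)) \<in> rel_ideal n"
proof -
  let ?K = "Poly_Mapping.keys p" and ?l = "Poly_Mapping.lookup p" and ?s = Poly_Mapping.single
  let ?g = "\<lambda>w. \<Sum>S | matching n S. ?s (matching_word S) (?l w * of_bool (distinct w \<and> set w = S))"
  have single_sum: "?s u (sum f A) = (\<Sum>i\<in>A. ?s u (f i))" for u and f :: "(nat \<times> nat) list \<Rightarrow> 'a" and A
    by (induction A rule: infinite_finite_induct) (simp_all add: single_add)
  have "p - (\<Sum>S | matching n S. ?s (matching_word S) (coeff S p))
      = (\<Sum>w\<in>?K. ?s w (?l w)) - (\<Sum>w\<in>?K. ?g w)"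
    using sum_single_lookup[of p] unfolding coeff_def single_sum by (subst (2) sum.swap) simp
  also have "\<dots> = (\<Sum>w\<in>?K. ?s w (?l w) - ?g w)" by (simp add: sum_subtractf)
  also have "\<dots> \<in> rel_ideal n"
  proof (rule rel_ideal_sum)
    fix w assume "w \<in> ?K"
    then have w: "set w \<subseteq> cycle_edges n" using p by auto
    have s: "?s [] (?l w) * ?s u 1 = ?s u (?l w)" for u by (simp add: mult_single plus_list_def)
    show "?s w (?l w) - ?g w \<in> rel_ideal n"
    proof (cases "distinct w \<and> matching n (set w)")
      case True
      have "?g w = (\<Sum>S | matching n S. if S = set w then ?s (matching_word (set w)) (?l w) else 0)"
        using True by (intro sum.cong) auto
      also have "\<dots> = ?s (matching_word (set w)) (?l w)" using True by (simp add: sum.delta)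
      finally have g: "?g w = \<dots>" .
      have "word_cong TYPE('a) w (matching_word (set w))"
        using True matching_word by (intro word_cong_if_same_matching) auto
      then have "?s [] (?l w) * (?s w 1 - ?s (matching_word (set w)) 1) \<in> rel_ideal n"
        unfolding word_cong_def by (intro rel_ideal_mult) auto
      then show ?thesis unfolding g right_diff_distrib s .
    next
      case False
      then have "?g w = 0" by (intro sum.neutral) auto
      moreover have "?s [] (?l w) * ?s w 1 \<in> rel_ideal n"
        using word_null_if_not_matching[OF w False, of "TYPE('a)"]
        unfolding word_null_def by (intro rel_ideal_mult) auto
      ultimately show ?thesis unfolding s by simp
    qed
  qed
  finally show ?thesis .
qed

text \<open>
  Linear independence of the matching monomials in the quotient (from left to right) and the fact
  that they span it (from right to left), in one statement.
\<close>

lemma rel_ideal_iff_coeff: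
  fixes p :: "'a::field nc_poly"
  assumes p: "Poly_Mapping.keys p \<subseteq> lists (cycle_edges n)"
  shows "p \<in> rel_ideal n \<longleftrightarrow> (\<forall>S. matching n S \<longrightarrow> coeff S p = 0)"
  using normal_form[OF p] coeff_rel_ideal by auto

end

section \<open>Independent sets of a path and Fibonacci polynomials\<close>

definition sparse :: "nat set \<Rightarrow> bool" where
  "sparse A \<longleftrightarrow> (\<forall>k\<in>A. Suc k \<notin> A)"

text \<open>
  The weighted independence polynomial of a path with vertices \<open>0, \<dots>, m - 1\<close>.
\<close>

definition sparse_sum :: "(nat \<Rightarrow> 'b::comm_semiring_1) \<Rightarrow> nat \<Rightarrow> 'b" where
  "sparse_sum w m = (\<Sum>A | A \<subseteq> {..<m} \<and> sparse A. \<Prod>k\<in>A. w k)"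

lemma sparse_sum_0: "sparse_sum w 0 = 1"
proof -
  have "{A. A \<subseteq> {..<0::nat} \<and> sparse A} = {{}}" by (auto simp: sparse_def)
  then show ?thesis by (simp add: sparse_sum_def)
qed

lemma sparse_sum_1: "sparse_sum w (Suc 0) = 1 + w 0"
proof -
  have "{A. A \<subseteq> {..<Suc 0} \<and> sparse A} = {{}, {0}}"
    by (auto simp: sparse_def lessThan_Suc subset_singleton_iff)
  then show ?thesis by (simp add: sparse_sum_def)
qed

text \<open>
  Split according to whether the last vertex is chosen; if it is, its neighbour is not.
\<close>

lemma sparse_sum_rec:
  "sparse_sum w (Suc (Suc m)) = sparse_sum w (Suc m) + w (Suc m) * sparse_sum w m"
proof -
  let ?P = "\<lambda>m. {A. A \<subseteq> {..<m} \<and> sparse A}"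
  have fin: "finite (?P m)" for m by (rule finite_subset[of _ "Pow {..<m}"]) auto
  have split: "?P (Suc (Suc m)) = ?P (Suc m) \<union> insert (Suc m) ` ?P m" (is "?L = ?R")
  proof (intro subset_antisym subsetI)
    fix A assume A: "A \<in> ?L"
    show "A \<in> ?R"
    proof (cases "Suc m \<in> A")
      case False
      then have "A \<subseteq> {..<Suc m}" using A by (auto simp: lessThan_Suc)
      then show ?thesis using A by auto
    next
      case True
      then have "m \<notin> A" using A by (auto simp: sparse_def)
      then have "A - {Suc m} \<in> ?P m" using A by (auto simp: lessThan_Suc sparse_def)
      moreover have "A = insert (Suc m) (A - {Suc m})" using True by auto
      ultimately show ?thesis by blast
    qed
  next
    fix A assume "A \<in> ?R"
    then consider "A \<in> ?P (Suc m)" | B where "B \<in> ?P m" "A = insert (Suc m) B" by blast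
    then show "A \<in> ?L"
      by cases (auto simp: sparse_def lessThan_Suc)
  qed
  have inj: "inj_on (insert (Suc m)) (?P m)"
  proof (rule inj_onI)
    fix A B assume AB: "A \<in> ?P m" "B \<in> ?P m" and eq: "insert (Suc m) A = insert (Suc m) B"
    have "Suc m \<notin> A" "Suc m \<notin> B" using AB by auto
    then show "A = B" using eq by (simp add: insert_ident)
  qed
  have "(\<Sum>A\<in>insert (Suc m) ` ?P m. \<Prod>k\<in>A. w k) = (\<Sum>A\<in>?P m. \<Prod>k\<in>insert (Suc m) A. w k)"
    using sum.reindex[OF inj] by simp
  also have "\<dots> = (\<Sum>A\<in>?P m. w (Suc m) * (\<Prod>k\<in>A. w k))"
  proof (rule sum.cong[OF refl])
    fix A assume "A \<in> ?P m"
    then have "finite A" "Suc m \<notin> A" using finite_subset by auto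
    then show "(\<Prod>k\<in>insert (Suc m) A. w k) = w (Suc m) * (\<Prod>k\<in>A. w k)" by simp
  qed
  finally have "(\<Sum>A\<in>insert (Suc m) ` ?P m. \<Prod>k\<in>A. w k) = w (Suc m) * sparse_sum w m"
    by (simp add: sparse_sum_def sum_distrib_left)
  moreover have "?P (Suc m) \<inter> insert (Suc m) ` ?P m = {}" by auto
  ultimately show ?thesis
    using fin unfolding sparse_sum_def split by (subst sum.union_disjoint) auto
qed

lemma q_fib_0: "q_fib 0 q = 1" and q_fib_1: "q_fib (Suc 0) q = 1"
  by (simp_all add: q_fib_def)

lemma q_fib_superset:
  assumes "m div 2 \<le> N" "N \<le> m"
  shows "q_fib m q = (\<Sum>k\<le>N. of_nat ((m - k) choose k) * q ^ k)"
  unfolding q_fib_def using assms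
  by (intro sum.mono_neutral_left) (auto simp: binomial_eq_0)

lemma q_fib_rec: "q_fib (Suc (Suc m)) q = q_fib (Suc m) q + q * q_fib m q"
proof -
  have "q_fib (Suc (Suc m)) q = (\<Sum>k\<le>Suc m. of_nat ((Suc (Suc m) - k) choose k) * q ^ k)"
    by (rule q_fib_superset) auto
  also have "\<dots> = 1 + (\<Sum>k\<le>m. of_nat ((Suc m - k) choose Suc k) * q ^ Suc k)"
    by (subst sum.atMost_Suc_shift) simp
  also have "(\<Sum>k\<le>m. of_nat ((Suc m - k) choose Suc k) * q ^ Suc k)
      = (\<Sum>k\<le>m. of_nat ((m - k) choose Suc k) * q ^ Suc k + q * (of_nat ((m - k) choose k) * q ^ k))"
    by (intro sum.cong refl) (simp add: Suc_diff_le algebra_simps)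
  also have "1 + \<dots> = (1 + (\<Sum>k\<le>m. of_nat ((m - k) choose Suc k) * q ^ Suc k))
      + q * (\<Sum>k\<le>m. of_nat ((m - k) choose k) * q ^ k)"
    by (simp add: sum.distrib sum_distrib_left add.assoc)
  also have "1 + (\<Sum>k\<le>m. of_nat ((m - k) choose Suc k) * q ^ Suc k)
      = (\<Sum>k\<le>Suc m. of_nat ((Suc m - k) choose k) * q ^ k)"
    by (subst sum.atMost_Suc_shift) simp
  also have "\<dots> = q_fib (Suc m) q" by (rule q_fib_superset[symmetric]) auto
  also have "(\<Sum>k\<le>m. of_nat ((m - k) choose k) * q ^ k) = q_fib m q"
    by (rule q_fib_superset[symmetric]) auto
  finally show ?thesis .
qed

text \<open>
  Both sides satisfy the recurrence \<open>a (m + 2) = a (m + 1) + y\<^sup>2 * a m\<close>.  The summand with the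
  factor \<open>y\<close> counts the sets containing the vertex \<open>0\<close>.
\<close>

lemma sparse_sum_one_light_end:
  assumes "w 0 = y" and "\<And>k. 0 < k \<Longrightarrow> k < Suc m \<Longrightarrow> w k = y ^ 2"
  shows "sparse_sum w (Suc m) = q_fib (Suc m) (y ^ 2) + y * q_fib m (y ^ 2)"
  using assms(2)
proof (induction m rule: induct_nat_012)
  case 0
  then show ?case by (simp add: sparse_sum_1 q_fib_0 q_fib_1 assms(1))
next
  case 1
  then show ?case
    by (simp add: sparse_sum_rec sparse_sum_0 sparse_sum_1 q_fib_rec q_fib_0 q_fib_1 assms(1) algebra_simps)
next
  case (ge2 m)
  have "sparse_sum w (Suc (Suc (Suc m)))
      = (q_fib (Suc (Suc m)) (y ^ 2) + y * q_fib (Suc m) (y ^ 2))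
        + y ^ 2 * (q_fib (Suc m) (y ^ 2) + y * q_fib m (y ^ 2))"
    using ge2 by (simp add: sparse_sum_rec[of w "Suc m"])
  then show ?case by (simp add: q_fib_rec algebra_simps)
qed

lemma sparse_sum_two_light_ends:
  assumes "h \<ge> 2" "w 0 = y" "w h = y" "\<And>k. 0 < k \<Longrightarrow> k < h \<Longrightarrow> w k = y ^ 2"
  shows "sparse_sum w (Suc h) = q_fib h (y ^ 2) + 2 * y * q_fib (h - 1) (y ^ 2) + y ^ 2 * q_fib (h - 2) (y ^ 2)"
proof -
  obtain m where h: "h = Suc (Suc m)" using assms(1) by (metis add_2_eq_Suc le_Suc_ex)
  have "sparse_sum w (Suc h) = sparse_sum w (Suc (Suc m)) + y * sparse_sum w (Suc m)"
    using assms h by (simp add: sparse_sum_rec)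
  also have "\<dots> = q_fib (Suc (Suc m)) (y ^ 2) + y * q_fib (Suc m) (y ^ 2)
      + y * (q_fib (Suc m) (y ^ 2) + y * q_fib m (y ^ 2))"
    using assms h by (subst (1 2) sparse_sum_one_light_end[where y = y]) auto
  finally show ?thesis using h by (simp add: algebra_simps power2_eq_square mult_2)
qed

section \<open>Matchings invariant under the reflection\<close>

definition reflect_edge :: "nat \<Rightarrow> nat \<times> nat \<Rightarrow> nat \<times> nat" where
  "reflect_edge n e = (n + 1 - snd e, n + 1 - fst e)"

text \<open>
  The edges in cyclic order, starting from \<open>(1, n)\<close>.  This edge gets the number 0 so that the
  reflection becomes \<open>k \<mapsto> n - k\<close> modulo \<open>n\<close>.
\<close>

definition edge :: "nat \<Rightarrow> nat \<Rightarrow> nat \<times> nat" where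
  "edge n k = (if k = 0 then (1, n) else (k, k + 1))"

lemma cycle_edges_eq_edge: "n \<ge> 4 \<Longrightarrow> cycle_edges n = edge n ` {..<n}"
proof -
  assume n: "n \<ge> 4"
  have "{(m, m + 1) | m. 1 \<le> m \<and> m \<le> n - 1} = edge n ` {0<..<n}"
  proof (intro subset_antisym subsetI)
    fix e assume "e \<in> {(m, m + 1) | m. 1 \<le> m \<and> m \<le> n - 1}"
    then obtain m where "e = (m, m + 1)" "1 \<le> m" "m \<le> n - 1" by blast
    then show "e \<in> edge n ` {0<..<n}" using n by (intro image_eqI[of _ _ m]) (auto simp: edge_def)
  qed (auto simp: edge_def)
  moreover have "{..<n} = {0<..<n} \<union> {0}" using n by auto
  ultimately have "edge n ` {..<n} = {(m, m + 1) | m. 1 \<le> m \<and> m \<le> n - 1} \<union> {edge n 0}" by auto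
  then show ?thesis by (simp add: cycle_edges_def edge_def)
qed

lemma edge_inj:
  assumes "n \<ge> 4" "k < n" "l < n" "edge n k = edge n l"
  shows "k = l"
  using assms by (auto simp: edge_def split: if_splits)

lemma incident_edge_iff:
  assumes "n \<ge> 4" "k < n" "l < n"
  shows "incident (edge n k) (edge n l) \<longleftrightarrow>
    k = l \<or> Suc k = l \<or> Suc l = k \<or> k = 0 \<and> l = n - 1 \<or> l = 0 \<and> k = n - 1"
  using assms by (auto simp: incident_def edge_def)

lemma reflect_edge_edge:
  assumes "n \<ge> 4" "k < n"
  shows "reflect_edge n (edge n k) = edge n (if k = 0 then 0 else n - k)"
  using assms by (auto simp: reflect_edge_def edge_def)

lemma reflect_edge_cycle:
  assumes "n \<ge> 4" "e \<in> cycle_edges n"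
  shows "reflect_edge n e \<in> cycle_edges n" "reflect_edge n (reflect_edge n e) = e"
proof -
  obtain k where k: "k < n" "e = edge n k" using assms cycle_edges_eq_edge by auto
  then show "reflect_edge n e \<in> cycle_edges n" "reflect_edge n (reflect_edge n e) = e"
    using assms(1) by (auto simp: reflect_edge_edge cycle_edges_eq_edge)
qed

lemma reflect_matching:
  assumes "n \<ge> 4" "matching n S"
  shows "matching n (reflect_edge n ` S)" "reflect_edge n ` reflect_edge n ` S = S"
proof -
  have S: "S \<subseteq> cycle_edges n" using assms(2) by (simp add: matching_def)
  then show "reflect_edge n ` reflect_edge n ` S = S"
    using reflect_edge_cycle(2)[OF assms(1)] by (force simp: image_image)
  have "\<not> incident (reflect_edge n e) (reflect_edge n f)"
    if "e \<in> S" "f \<in> S" "reflect_edge n e \<noteq> reflect_edge n f" for e f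
  proof -
    have bound: "fst g \<le> n" "snd g \<le> n" if "g \<in> S" for g
      using S that assms(1) by (fastforce simp: cycle_edges_def)+
    have "\<not> incident e f" using that assms(2) unfolding matching_def by auto
    then show ?thesis using bound[OF that(1)] bound[OF that(2)]
      by (auto simp: incident_def reflect_edge_def)
  qed
  then show "matching n (reflect_edge n ` S)"
    using S reflect_edge_cycle(1)[OF assms(1)] unfolding matching_def by blast
qed

text \<open>
  The invariant set of edges generated by the edges with numbers in \<open>A\<close>.
\<close>

definition symmetrize :: "nat \<Rightarrow> nat set \<Rightarrow> (nat \<times> nat) set" where
  "symmetrize n A = (\<Union>k\<in>A. {edge n k, reflect_edge n (edge n k)})"

context
  fixes n h :: nat
  assumes n: "n \<ge> 4" and h: "n = 2 * h"
begin

lemma symmetrize_edge [consumes 2]: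
  assumes e: "e \<in> symmetrize n A" and A: "A \<subseteq> {..<Suc h}"
  obtains k where "k \<in> A" "e = edge n k" | k where "k \<in> A" "0 < k" "e = edge n (n - k)"
proof -
  obtain k where k: "k \<in> A" "e = edge n k \<or> e = reflect_edge n (edge n k)"
    using e by (auto simp: symmetrize_def)
  then have "k < n" using A n h by auto
  then show thesis using k that reflect_edge_edge[OF n] by (cases "k = 0") auto
qed

lemma edge_in_symmetrize_iff:
  assumes "A \<subseteq> {..<Suc h}" "k \<le> h"
  shows "edge n k \<in> symmetrize n A \<longleftrightarrow> k \<in> A"
proof
  assume "edge n k \<in> symmetrize n A"
  then show "k \<in> A"
    using assms(1)
  proof (cases rule: symmetrize_edge)
    case (1 l)
    then show ?thesis using edge_inj[OF n, of k l] assms n h by auto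
  next
    case (2 l)
    then have "l \<le> h" using assms by auto
    then have "k = n - l" using edge_inj[OF n, of k "n - l"] 2 assms n h by auto
    then have "k = l" using assms(2) \<open>l \<le> h\<close> h by auto
    then show ?thesis using 2 by simp
  qed
qed (auto simp: symmetrize_def)

text \<open>
  Each orbit of the reflection has one number in \<open>0, \<dots>, h\<close>, where \<open>h = n div 2\<close>, and orbits
  of nonconsecutive numbers in this range are not incident.  The only new incidences between
  an edge \<open>k\<close> and a reflected edge \<open>n - l\<close> would need \<open>k + l = n - 1\<close>, that is
  \<open>{k, l} = {h - 1, h}\<close>, or \<open>{k, l} = {0, 1}\<close>.
\<close>

lemma matching_symmetrize:
  assumes A: "A \<subseteq> {..<Suc h}" "sparse A"
  shows "matching n (symmetrize n A)"
proof -
  have lt: "k \<le> h" if "k \<in> A" for k using A that by auto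
  have ad: "l \<noteq> Suc k" if "k \<in> A" "l \<in> A" for k l using A(2) that by (auto simp: sparse_def)
  have not_odd: "Suc (k + l) \<noteq> 2 * h" if "k \<in> A" "l \<in> A" for k l
    using lt[OF that(1)] lt[OF that(2)] ad[OF that] ad[OF that(2,1)] by arith
  have "e = f" if "e \<in> symmetrize n A" "f \<in> symmetrize n A" "incident e f" for e f
    using that(1) A(1)
  proof (cases rule: symmetrize_edge)
    case k: (1 k)
    show ?thesis using that(2) A(1)
    proof (cases rule: symmetrize_edge)
      case l: (1 l)
      then show ?thesis
        using that(3) k lt[of k] lt[of l] ad[of k l] ad[of l k] n h
        by (auto simp: incident_edge_iff)
    next
      case l: (2 l)
      then have "k = n - l \<or> Suc k = n - l \<or> Suc (n - l) = k \<or> k = 0 \<and> n - l = n - 1"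
        using that(3) k lt[of k] lt[of l] n h by (auto simp: incident_edge_iff)
      then have "k = n - l \<or> Suc (k + l) = 2 * h \<or> k = Suc l \<or> l = Suc k"
        using l(2) lt[OF k(1)] lt[OF l(1)] n h by (elim disjE conjE) linarith+
      then have "k = n - l"
        using not_odd[OF k(1) l(1)] ad[OF k(1) l(1)] ad[OF l(1) k(1)] by blast
      then show ?thesis using k l by simp
    qed
  next
    case k: (2 k)
    show ?thesis using that(2) A(1)
    proof (cases rule: symmetrize_edge)
      case l: (1 l)
      then have "l = n - k \<or> Suc l = n - k \<or> Suc (n - k) = l \<or> l = 0 \<and> n - k = n - 1"
        using that(3) k lt[of k] lt[of l] n h by (auto simp: incident_edge_iff)
      then have "l = n - k \<or> Suc (k + l) = 2 * h \<or> k = Suc l \<or> l = Suc k"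
        using k(2) lt[OF k(1)] lt[OF l(1)] n h by (elim disjE conjE) linarith+
      then have "l = n - k"
        using not_odd[OF k(1) l(1)] ad[OF k(1) l(1)] ad[OF l(1) k(1)] by blast
      then show ?thesis using k l by simp
    next
      case l: (2 l)
      then have "n - k = n - l \<or> Suc (n - k) = n - l \<or> Suc (n - l) = n - k"
        using that(3) k lt[of k] lt[of l] n h by (auto simp: incident_edge_iff)
      then have "n - k = n - l \<or> k = Suc l \<or> l = Suc k"
        using lt[OF k(1)] lt[OF l(1)] n h by (elim disjE conjE) linarith+
      then have "n - k = n - l" using ad[OF k(1) l(1)] ad[OF l(1) k(1)] by blast
      then show ?thesis using k l by simp
    qed
  qed
  moreover have "symmetrize n A \<subseteq> cycle_edges n"
  proof
    fix e assume "e \<in> symmetrize n A"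
    then show "e \<in> cycle_edges n"
      using A(1)
    proof (cases rule: symmetrize_edge)
      case (1 k) then show ?thesis using lt[of k] n h by (auto simp: cycle_edges_eq_edge)
    next
      case (2 k) then show ?thesis using lt[of k] n h by (auto simp: cycle_edges_eq_edge)
    qed
  qed
  ultimately show ?thesis unfolding matching_def by blast
qed

lemma reflect_symmetrize:
  assumes "A \<subseteq> {..<Suc h}"
  shows "reflect_edge n ` symmetrize n A = symmetrize n A"
proof -
  have "reflect_edge n (reflect_edge n (edge n k)) = edge n k" if "k \<in> A" for k
    using that assms n h by (intro reflect_edge_cycle(2)) (auto simp: cycle_edges_eq_edge)
  then show ?thesis unfolding symmetrize_def image_UN by auto
qed

lemma symmetrize_traces:
  assumes S: "matching n S" "reflect_edge n ` S = S"
  shows "symmetrize n {k. k \<le> h \<and> edge n k \<in> S} = S" "sparse {k. k \<le> h \<and> edge n k \<in> S}"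
proof -
  show "symmetrize n {k. k \<le> h \<and> edge n k \<in> S} = S"
  proof
    show "symmetrize n {k. k \<le> h \<and> edge n k \<in> S} \<subseteq> S"
      using S(2) by (auto simp: symmetrize_def)
    show "S \<subseteq> symmetrize n {k. k \<le> h \<and> edge n k \<in> S}"
    proof
      fix e assume e: "e \<in> S"
      then obtain m where m: "m < n" "e = edge n m"
        using S(1) cycle_edges_eq_edge[OF n] unfolding matching_def by auto
      show "e \<in> symmetrize n {k. k \<le> h \<and> edge n k \<in> S}"
      proof (cases "m \<le> h")
        case True
        then show ?thesis using e m by (auto simp: symmetrize_def)
      next
        case False
        \<comment> \<open>An edge in the upper half is the mirror image of one in the lower half.\<close>
        then have r: "reflect_edge n e = edge n (n - m)" "n - m \<le> h" "n - m < n" "0 < n - m"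
          using m n h by (auto simp: reflect_edge_edge)
        have "edge n (n - m) \<in> S" using S(2) e r(1) by (metis imageI)
        moreover have "reflect_edge n (edge n (n - m)) = e"
          using m r n by (simp add: reflect_edge_edge)
        ultimately show ?thesis using r(2) unfolding symmetrize_def by blast
      qed
    qed
  qed
  show "sparse {k. k \<le> h \<and> edge n k \<in> S}"
    unfolding sparse_def
  proof
    fix k assume k: "k \<in> {k. k \<le> h \<and> edge n k \<in> S}"
    show "Suc k \<notin> {k. k \<le> h \<and> edge n k \<in> S}"
    proof
      assume s: "Suc k \<in> {k. k \<le> h \<and> edge n k \<in> S}"
      then have "Suc k < n" using n h by auto
      then have "incident (edge n k) (edge n (Suc k))" "edge n k \<noteq> edge n (Suc k)"
        using incident_edge_iff[OF n, of k "Suc k"] edge_inj[OF n, of k "Suc k"] by auto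
      then show False using S(1) k s unfolding matching_def by auto
    qed
  qed
qed

text \<open>
  The orbits are pairs, except for the two fixed edges, which have the numbers \<open>0\<close> and \<open>h\<close>.
\<close>

lemma power_card_symmetrize:
  assumes A: "A \<subseteq> {..<Suc h}"
  shows "(y :: 'b::comm_monoid_mult) ^ card (symmetrize n A) = (\<Prod>k\<in>A. if k = 0 \<or> k = h then y else y ^ 2)"
proof -
  have fin: "finite A" using A finite_subset by blast
  have lt: "k \<le> h" if "k \<in> A" for k using A that by auto
  have r: "reflect_edge n (edge n k) = edge n (if k = 0 then 0 else n - k)" if "k \<in> A" for k
    using lt[OF that] n h by (intro reflect_edge_edge) auto
  have ne: "edge n i \<noteq> edge n j" if "i < n" "j < n" "i \<noteq> j" for i j
    using edge_inj[OF n that(1,2)] that(3) by blast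
  have disj: "{edge n k, reflect_edge n (edge n k)} \<inter> {edge n l, reflect_edge n (edge n l)} = {}"
    if kl: "k \<in> A" "l \<in> A" "k \<noteq> l" for k l
  proof -
    let ?r = "\<lambda>k. if k = 0 then 0 else n - k"
    have *: "k < n" "l < n" "?r k < n" "?r l < n"
      using kl lt[of k] lt[of l] n h by auto
    have **: "k \<noteq> ?r l" "?r k \<noteq> l" "?r k \<noteq> ?r l"
      using kl lt[of k] lt[of l] n h by auto
    show ?thesis
      using ne[OF *(1,2) kl(3)] ne[OF *(1,4) **(1)] ne[OF *(3,2) **(2)] ne[OF *(3,4) **(3)]
      unfolding r[OF kl(1)] r[OF kl(2)] by blast
  qed
  have "y ^ card (symmetrize n A) = (\<Prod>e\<in>symmetrize n A. y)" by simp
  also have "\<dots> = (\<Prod>k\<in>A. \<Prod>e\<in>{edge n k, reflect_edge n (edge n k)}. y)"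
    unfolding symmetrize_def using fin disj by (intro prod.UNION_disjoint) auto
  also have "\<dots> = (\<Prod>k\<in>A. if k = 0 \<or> k = h then y else y ^ 2)"
  proof (rule prod.cong[OF refl])
    fix k assume k: "k \<in> A"
    show "(\<Prod>e\<in>{edge n k, reflect_edge n (edge n k)}. y) = (if k = 0 \<or> k = h then y else y ^ 2)"
    proof (cases "k = 0 \<or> k = h")
      case True
      then have "reflect_edge n (edge n k) = edge n k" using r[OF k] n h by auto
      then show ?thesis using True by simp
    next
      case False
      then have "edge n k \<noteq> edge n (n - k)" using lt[OF k] n h by (intro ne) auto
      then show ?thesis using False r[OF k] by (simp add: power2_eq_square)
    qed
  qed
  finally show ?thesis .
qed

text \<open>
  Invariant matchings correspond to sets of pairwise nonconsecutive orbit representatives, that is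
  to independent sets of the path \<open>0, \<dots>, h\<close>.
\<close>

lemma sum_symmetric_matchings:
  fixes y :: "'b::comm_semiring_1"
  shows "(\<Sum>S | matching n S \<and> reflect_edge n ` S = S. y ^ card S)
       = q_fib h (y ^ 2) + 2 * y * q_fib (h - 1) (y ^ 2) + y ^ 2 * q_fib (h - 2) (y ^ 2)"
proof -
  let ?w = "\<lambda>k. if k = 0 \<or> k = h then y else y ^ 2"
  have "(\<Sum>S | matching n S \<and> reflect_edge n ` S = S. y ^ card S)
      = (\<Sum>A | A \<subseteq> {..<Suc h} \<and> sparse A. \<Prod>k\<in>A. ?w k)"
  proof (rule sum.reindex_bij_witness[of _ "symmetrize n" "\<lambda>S. {k. k \<le> h \<and> edge n k \<in> S}"])
    fix S assume "S \<in> {S. matching n S \<and> reflect_edge n ` S = S}"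
    then have S: "matching n S" "reflect_edge n ` S = S" by auto
    show "symmetrize n {k. k \<le> h \<and> edge n k \<in> S} = S" by (rule symmetrize_traces[OF S])
    show "{k. k \<le> h \<and> edge n k \<in> S} \<in> {A. A \<subseteq> {..<Suc h} \<and> sparse A}"
      using symmetrize_traces(2)[OF S] by auto
    have "y ^ card (symmetrize n {k. k \<le> h \<and> edge n k \<in> S}) = prod ?w {k. k \<le> h \<and> edge n k \<in> S}"
      by (rule power_card_symmetrize) auto
    then show "prod ?w {k. k \<le> h \<and> edge n k \<in> S} = y ^ card S"
      by (simp only: symmetrize_traces(1)[OF S])
  next
    fix A assume "A \<in> {A. A \<subseteq> {..<Suc h} \<and> sparse A}"
    then have A: "A \<subseteq> {..<Suc h}" "sparse A" by auto
    show "{k. k \<le> h \<and> edge n k \<in> symmetrize n A} = A"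
      using edge_in_symmetrize_iff[OF A(1)] A(1) by auto
    show "symmetrize n A \<in> {S. matching n S \<and> reflect_edge n ` S = S}"
      using matching_symmetrize[OF A] reflect_symmetrize[OF A(1)] by simp
  qed
  also have "\<dots> = sparse_sum ?w (Suc h)" by (simp add: sparse_sum_def)
  also have "\<dots> = q_fib h (y ^ 2) + 2 * y * q_fib (h - 1) (y ^ 2) + y ^ 2 * q_fib (h - 2) (y ^ 2)"
    using n h by (intro sparse_sum_two_light_ends) auto
  finally show ?thesis .
qed

end

section \<open>The action of the reflection\<close>

lemma nc_subst_eq_sum:
  assumes "\<And>w. w \<in> Poly_Mapping.keys p \<Longrightarrow>
    prod_list (map (\<lambda>(i, j). X (\<sigma> i) (\<sigma> j)) w) = Poly_Mapping.single (f w) (g w)"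
  shows "nc_subst \<sigma> p = (\<Sum>w\<in>Poly_Mapping.keys p. Poly_Mapping.single (f w) (Poly_Mapping.lookup p w * g w))"
  unfolding nc_subst_def using assms
  by (intro sum.cong) (simp_all add: scalar_def mult_single plus_list_def)

context
  fixes n :: nat
  assumes n: "n \<ge> 4"
begin

text \<open>
  The reflection reverses the order of the two ends of every edge, \<open>(1, n)\<close> included, so every
  letter contributes a sign.
\<close>

lemma subst_reflection_word:
  assumes "set w \<subseteq> cycle_edges n"
  shows "prod_list (map (\<lambda>(i, j). X (cycle_reflection n i) (cycle_reflection n j)) w)
       = Poly_Mapping.single (map (reflect_edge n) w) ((-1 :: 'a::field) ^ length w)"
  using assms
proof (induction w)
  case Nil
  then show ?case by (simp add: one_nc_poly)
next
  case (Cons e w)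
  obtain i j where e: "e = (i, j)" by (metis surj_pair)
  then have ij: "1 \<le> i" "i < j" "j \<le> n" using Cons.prems n by (auto simp: cycle_edges_def)
  then have "X (cycle_reflection n i) (cycle_reflection n j)
      = Poly_Mapping.single [reflect_edge n e] (-1 :: 'a)"
    by (auto simp: X_def cycle_reflection_def reflect_edge_def e single_uminus)
  then show ?case using Cons by (simp add: e mult_single plus_list_def)
qed

lemma nc_subst_reflection:
  fixes p :: "'a::field nc_poly"
  assumes "Poly_Mapping.keys p \<subseteq> lists (cycle_edges n)"
  shows "nc_subst (cycle_reflection n) p = (\<Sum>w\<in>Poly_Mapping.keys p.
    Poly_Mapping.single (map (reflect_edge n) w) (Poly_Mapping.lookup p w * (-1) ^ length w))"
  using assms by (intro nc_subst_eq_sum subst_reflection_word) auto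

lemma reflection_carrier:
  fixes p :: "'a::field nc_poly"
  assumes p: "Poly_Mapping.keys p \<subseteq> lists (cycle_edges n)"
  shows "Poly_Mapping.keys (nc_subst (cycle_reflection n) p) \<subseteq> lists (cycle_edges n)"
  unfolding nc_subst_reflection[OF p]
proof (rule carrier_sum)
  fix w assume "w \<in> Poly_Mapping.keys p"
  then have "w \<in> lists (cycle_edges n)" using p by blast
  then have "map (reflect_edge n) w \<in> lists (cycle_edges n)"
    using reflect_edge_cycle(1)[OF n] by (induction w) simp_all
  then show "Poly_Mapping.keys (Poly_Mapping.single (map (reflect_edge n) w)
      (Poly_Mapping.lookup p w * (-1) ^ length w)) \<subseteq> lists (cycle_edges n)"
    unfolding keys_single by simp
qed

lemma keys_sum_subset:
  fixes f :: "'i \<Rightarrow> 'k \<Rightarrow>\<^sub>0 'b::comm_monoid_add"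
  shows "Poly_Mapping.keys (\<Sum>i\<in>I. f i) \<subseteq> (\<Union>i\<in>I. Poly_Mapping.keys (f i))"
proof (induction I rule: infinite_finite_induct)
  case (insert i I)
  then show ?case using Poly_Mapping.keys_add[of "f i" "sum f I"] by auto
qed simp_all

lemma reflection_homogeneous:
  fixes p :: "'a::field nc_poly"
  assumes p: "Poly_Mapping.keys p \<subseteq> lists (cycle_edges n)" and d: "\<forall>w\<in>Poly_Mapping.keys p. length w = d"
  shows "\<forall>w\<in>Poly_Mapping.keys (nc_subst (cycle_reflection n) p). length w = d"
proof
  fix w assume "w \<in> Poly_Mapping.keys (nc_subst (cycle_reflection n) p)"
  then have "w \<in> (\<Union>u\<in>Poly_Mapping.keys p. Poly_Mapping.keys (Poly_Mapping.single
      (map (reflect_edge n) u) (Poly_Mapping.lookup p u * (-1) ^ length u)))"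
    unfolding nc_subst_reflection[OF p] by (rule subsetD[OF keys_sum_subset])
  then obtain u where u: "u \<in> Poly_Mapping.keys p" "w = map (reflect_edge n) u"
    unfolding keys_single by (auto simp only: UN_iff split: if_splits)
  then show "length w = d" using d by simp
qed

lemma coeff_reflection:
  fixes p :: "'a::field nc_poly"
  assumes p: "Poly_Mapping.keys p \<subseteq> lists (cycle_edges n)" and S: "matching n S"
  shows "coeff S (nc_subst (cycle_reflection n) p) = (-1) ^ card S * coeff (reflect_edge n ` S) p"
proof -
  let ?r = "reflect_edge n"
  have key: "(-1) ^ length w * of_bool (distinct (map ?r w) \<and> set (map ?r w) = S)
      = (-1) ^ card S * (of_bool (distinct w \<and> set w = ?r ` S) :: 'a)"
    if "w \<in> Poly_Mapping.keys p" for w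
  proof -
    have w: "e \<in> cycle_edges n" if "e \<in> set w" for e
      using that \<open>w \<in> Poly_Mapping.keys p\<close> p by auto
    have inj: "inj_on ?r (set w)"
      by (rule inj_on_inverseI[of _ ?r]) (simp add: w reflect_edge_cycle(2)[OF n])
    have "?r ` ?r ` set w = id ` set w"
      unfolding image_image by (rule image_cong) (simp_all add: w reflect_edge_cycle(2)[OF n])
    then have eq: "?r ` set w = S \<longleftrightarrow> set w = ?r ` S"
      using reflect_matching(2)[OF n S] by auto
    show ?thesis
    proof (cases "distinct w \<and> set w = ?r ` S")
      case True
      then have "length w = card S"
        using eq card_image[OF inj] distinct_card[of w] by simp
      then show ?thesis using True eq inj by (simp add: distinct_map)
    next
      case False
      then show ?thesis using eq by (auto simp: distinct_map)
    qed
  qed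
  have "coeff S (nc_subst (cycle_reflection n) p) = (\<Sum>w\<in>Poly_Mapping.keys p. Poly_Mapping.lookup p w *
      ((-1) ^ length w * of_bool (distinct (map ?r w) \<and> set (map ?r w) = S)))"
    unfolding nc_subst_reflection[OF p] coeff_sum coeff_single by (simp only: mult.assoc)
  also have "\<dots> = (\<Sum>w\<in>Poly_Mapping.keys p. (-1) ^ card S *
      (Poly_Mapping.lookup p w * of_bool (distinct w \<and> set w = ?r ` S)))"
    by (rule sum.cong[OF refl]) (simp only: key mult.left_commute)
  finally show ?thesis by (simp only: coeff_def sum_distrib_left)
qed

section \<open>The graded components of the quotient\<close>

text \<open>
  Identities in the quotient thus become identities between coefficients of matchings.
\<close>

lemma residue_class_eq_iff:
  fixes p q :: "'a::field nc_poly"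
  assumes p: "Poly_Mapping.keys p \<subseteq> lists (cycle_edges n)" and q: "Poly_Mapping.keys q \<subseteq> lists (cycle_edges n)"
  shows "residue_class n p = residue_class n q \<longleftrightarrow> (\<forall>S. matching n S \<longrightarrow> coeff S p = coeff S q)"
proof -
  interpret I: ideal "rel_ideal n" "free_algebra n" by (rule ideal_rel_ideal[OF n])
  have "residue_class n p = residue_class n q \<longleftrightarrow> p - q \<in> rel_ideal n"
  proof
    assume "residue_class n p = residue_class n q"
    then have "p \<in> residue_class n q"
      using I.a_rcos_self[of p] p unfolding residue_class_def by simp
    then show "p - q \<in> rel_ideal n"
      unfolding residue_class_def a_r_coset_def' by (auto simp: algebra_simps)
  next
    assume *: "p - q \<in> rel_ideal n"
    have "p = (p - q) \<oplus>\<^bsub>free_algebra n\<^esub> q" by simp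
    then have "p \<in> residue_class n q"
      using * unfolding residue_class_def a_r_coset_def' by blast
    then show "residue_class n p = residue_class n q"
      unfolding residue_class_def
      using I.a_repr_independence[OF _ _ I.a_subgroup, of p q] q by simp
  qed
  also have "\<dots> \<longleftrightarrow> (\<forall>S. matching n S \<longrightarrow> coeff S p = coeff S q)"
    using rel_ideal_iff_coeff[OF n carrier_closed(3)[OF p q]] by (simp add: coeff_diff)
  finally show ?thesis .
qed

lemma residue_class_mem:
  fixes p :: "'a::field nc_poly"
  assumes p: "Poly_Mapping.keys p \<subseteq> lists (cycle_edges n)" and q: "q \<in> residue_class n p"
  shows "Poly_Mapping.keys q \<subseteq> lists (cycle_edges n)" "residue_class n q = residue_class n p"
proof -
  interpret I: ideal "rel_ideal n" "free_algebra n" by (rule ideal_rel_ideal[OF n])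
  show "Poly_Mapping.keys q \<subseteq> lists (cycle_edges n)"
    using q p I.a_elemrcos_carrier[of p q] unfolding residue_class_def by simp
  show "residue_class n q = residue_class n p"
    using q p I.a_repr_independence[OF _ _ I.a_subgroup, of q p] unfolding residue_class_def by simp
qed

lemma FK_action_residue_class:
  fixes p :: "'a::field nc_poly"
  assumes p: "Poly_Mapping.keys p \<subseteq> lists (cycle_edges n)"
  shows "FK_action n (cycle_reflection n) (residue_class n p) = residue_class n (nc_subst (cycle_reflection n) p)"
proof -
  interpret I: ideal "rel_ideal n" "free_algebra n" by (rule ideal_rel_ideal[OF n])
  have "residue_class n (nc_subst (cycle_reflection n) q) = residue_class n (nc_subst (cycle_reflection n) p)"
    if "q \<in> residue_class n p" for q
  proof -
    note q = residue_class_mem[OF p that]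
    have "coeff S q = coeff S p" if "matching n S" for S
      using q(2) that residue_class_eq_iff[OF q(1) p] by blast
    then show ?thesis
      using residue_class_eq_iff[OF reflection_carrier[OF q(1)] reflection_carrier[OF p]]
        coeff_reflection[OF q(1)] coeff_reflection[OF p] reflect_matching(1)[OF n] by simp
  qed
  moreover have "p \<in> residue_class n p"
    using I.a_rcos_self[of p] p unfolding residue_class_def by simp
  ultimately show ?thesis unfolding FK_action_def by blast
qed

lemma FK_cycle_add:
  fixes p q :: "'a::field nc_poly"
  assumes "Poly_Mapping.keys p \<subseteq> lists (cycle_edges n)" "Poly_Mapping.keys q \<subseteq> lists (cycle_edges n)"
  shows "residue_class n p \<oplus>\<^bsub>FK_cycle n\<^esub> residue_class n q = residue_class n (p + q)"
proof -
  interpret I: ideal "rel_ideal n" "free_algebra n" by (rule ideal_rel_ideal[OF n])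
  show ?thesis
    using I.a_rcos_sum[of p q] assms by (simp add: FK_cycle_def Let_def FactRing_def residue_class_def)
qed

lemma keys_scalar: "Poly_Mapping.keys (scalar c) \<subseteq> lists E"
  by (simp add: scalar_def)

lemma FK_cycle_smult:
  fixes p :: "'a::field nc_poly"
  assumes "Poly_Mapping.keys p \<subseteq> lists (cycle_edges n)"
  shows "c \<odot>\<^bsub>FK_cycle n\<^esub> residue_class n p = residue_class n (scalar c * p)"
proof -
  interpret I: ideal "rel_ideal n" "free_algebra n" by (rule ideal_rel_ideal[OF n])
  show ?thesis
    using I.rcoset_mult_add[of "scalar c" p] assms keys_scalar[of c "cycle_edges n"]
    by (simp add: FK_cycle_def Let_def FactRing_def residue_class_def)
qed

lemma FK_cycle_zero: "\<zero>\<^bsub>FK_cycle n\<^esub> = residue_class n (0 :: 'a::field nc_poly)"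
proof -
  interpret I: ideal "rel_ideal n :: 'a nc_poly set" "free_algebra n" by (rule ideal_rel_ideal[OF n])
  show ?thesis by (simp add: FK_cycle_def Let_def FactRing_def residue_class_def a_r_coset_def')
qed

lemma lookup_scalar_mult: "Poly_Mapping.lookup (scalar c * p) w = c * Poly_Mapping.lookup p w"
proof -
  have "scalar c * p = Poly_Mapping.map ((*) c) p"
    by (simp add: scalar_def mult_map_scale_conv_mult zero_list_def)
  then show ?thesis by (simp add: map.rep_eq when_def)
qed

lemma coeff_scalar_mult: "coeff S (scalar c * p) = c * coeff S p"
proof -
  have "Poly_Mapping.keys (scalar c * p) \<subseteq> Poly_Mapping.keys p"
    by (auto simp: in_keys_iff lookup_scalar_mult)
  then have "coeff S (scalar c * p) = (\<Sum>w\<in>Poly_Mapping.keys p. Poly_Mapping.lookup (scalar c * p) w * of_bool (distinct w \<and> set w = S))"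
    by (intro coeff_superset) auto
  then show ?thesis unfolding coeff_def[of S p] by (simp only: lookup_scalar_mult sum_distrib_left mult.assoc)
qed

definition homogeneous :: "nat \<Rightarrow> 'a::field nc_poly set" where
  "homogeneous d = {p. Poly_Mapping.keys p \<subseteq> lists (cycle_edges n) \<and> (\<forall>w\<in>Poly_Mapping.keys p. length w = d)}"

lemma homogeneous_keys: "p \<in> homogeneous d \<Longrightarrow> Poly_Mapping.keys p \<subseteq> lists (cycle_edges n)"
  by (simp add: homogeneous_def)

lemma homogeneous_closed:
  "0 \<in> homogeneous d"
  "p \<in> homogeneous d \<Longrightarrow> q \<in> homogeneous d \<Longrightarrow> p + q \<in> homogeneous d"
  "p \<in> homogeneous d \<Longrightarrow> scalar c * p \<in> homogeneous d"
proof -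
  show "0 \<in> homogeneous d" by (simp add: homogeneous_def)
  show "p + q \<in> homogeneous d" if "p \<in> homogeneous d" "q \<in> homogeneous d"
    using that Poly_Mapping.keys_add[of p q] unfolding homogeneous_def by blast
  have "Poly_Mapping.keys (scalar c * p) \<subseteq> Poly_Mapping.keys p"
    by (auto simp: in_keys_iff lookup_scalar_mult)
  then show "scalar c * p \<in> homogeneous d" if "p \<in> homogeneous d"
    using that unfolding homogeneous_def by blast
qed

definition graded_piece :: "nat \<Rightarrow> ('a::field, 'a nc_poly set) module" where
  "graded_piece d = FK_cycle n\<lparr>carrier := FK_cycle_deg n d\<rparr>"

lemma graded_piece_carrier: "carrier (graded_piece d) = residue_class n ` homogeneous d"
  by (auto simp: graded_piece_def FK_cycle_deg_def homogeneous_def image_iff)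

lemma graded_piece_simps:
  fixes p q :: "'a::field nc_poly"
  shows "p \<in> homogeneous d \<Longrightarrow> q \<in> homogeneous d \<Longrightarrow>
      residue_class n p \<oplus>\<^bsub>graded_piece d\<^esub> residue_class n q = residue_class n (p + q)"
    and "p \<in> homogeneous d \<Longrightarrow> c \<odot>\<^bsub>graded_piece d\<^esub> residue_class n p = residue_class n (scalar c * p)"
    and "\<zero>\<^bsub>graded_piece d\<^esub> = residue_class n (0 :: 'a nc_poly)"
  using FK_cycle_add[of p q] FK_cycle_smult[of p c] FK_cycle_zero by (simp_all add: graded_piece_def homogeneous_keys)

lemma scalar_hom:
  "scalar (a * b) = scalar a * scalar b" "scalar (a + b) = scalar a + scalar b" "scalar 1 = 1"
  by (simp_all add: scalar_def mult_single plus_list_def single_add one_nc_poly)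

lemma vectorspace_graded_piece: "vectorspace class_ring (graded_piece d :: ('a::field, 'a nc_poly set) module)"
    (is "vectorspace _ ?V")
proof (rule vs_criteria)
  show "field (class_ring :: 'a ring)" by (rule class_field)
  show "\<zero>\<^bsub>?V\<^esub> \<in> carrier ?V" unfolding graded_piece_carrier graded_piece_simps
    using homogeneous_closed(1) by blast
  show "\<forall>v w. v \<in> carrier ?V \<and> w \<in> carrier ?V \<longrightarrow> v \<oplus>\<^bsub>?V\<^esub> w \<in> carrier ?V"
    unfolding graded_piece_carrier
    by (auto simp: graded_piece_simps homogeneous_closed)
  show "\<forall>v\<in>carrier ?V. \<exists>u\<in>carrier ?V. v \<oplus>\<^bsub>?V\<^esub> u = \<zero>\<^bsub>?V\<^esub>"
  proof
    fix v assume "v \<in> carrier ?V"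
    then obtain p where p: "p \<in> homogeneous d" "v = residue_class n p"
      unfolding graded_piece_carrier by auto
    have "- p \<in> homogeneous d" using p(1) by (simp add: homogeneous_def)
    then have "residue_class n (- p) \<in> carrier ?V" "v \<oplus>\<^bsub>?V\<^esub> residue_class n (- p) = \<zero>\<^bsub>?V\<^esub>"
      using graded_piece_simps(1)[OF p(1), of "- p"] graded_piece_simps(3) p(2)
      unfolding graded_piece_carrier by auto
    then show "\<exists>u\<in>carrier ?V. v \<oplus>\<^bsub>?V\<^esub> u = \<zero>\<^bsub>?V\<^esub>" by blast
  qed
qed (unfold graded_piece_carrier; auto simp: graded_piece_simps homogeneous_closed scalar_hom algebra_simps
   )+

text \<open>
  \<^const>\<open>coeff\<close> descended to the quotient, through an arbitrary representative.
\<close>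

definition class_coeff :: "(nat \<times> nat) set \<Rightarrow> 'a::field nc_poly set \<Rightarrow> 'a" where
  "class_coeff S C = coeff S (SOME p. Poly_Mapping.keys p \<subseteq> lists (cycle_edges n) \<and> residue_class n p = C)"

lemma class_coeff_residue_class:
  fixes p :: "'a::field nc_poly"
  assumes "Poly_Mapping.keys p \<subseteq> lists (cycle_edges n)" "matching n S"
  shows "class_coeff S (residue_class n p) = coeff S p"
proof -
  let ?q = "SOME q. Poly_Mapping.keys q \<subseteq> lists (cycle_edges n) \<and> residue_class n q = residue_class n p"
  have "Poly_Mapping.keys ?q \<subseteq> lists (cycle_edges n) \<and> residue_class n ?q = residue_class n p"
    by (rule someI[of _ p]) (use assms in simp)
  then show ?thesis
    unfolding class_coeff_def using residue_class_eq_iff[of ?q p] assms by blast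
qed

lemma matching_monomial_homogeneous:
  assumes "matching n S" "card S = d"
  shows "Poly_Mapping.single (matching_word S) c \<in> homogeneous d"
  using matching_word[OF n assms(1)] assms distinct_card[of "matching_word S"]
  by (auto simp: homogeneous_def matching_def)

lemma coeff_homogeneous:
  assumes "p \<in> homogeneous d" "coeff S p \<noteq> 0"
  shows "card S = d"
proof (rule ccontr)
  assume ne: "card S \<noteq> d"
  have "coeff S p = 0"
    unfolding coeff_def
  proof (rule sum.neutral, rule ballI)
    fix w assume "w \<in> Poly_Mapping.keys p"
    then have "length w = d" using assms(1) by (simp add: homogeneous_def)
    then have "\<not> (distinct w \<and> set w = S)" using ne distinct_card by metis
    then show "Poly_Mapping.lookup p w * of_bool (distinct w \<and> set w = S) = 0" by simp
  qed
  then show False using assms(2) by simp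
qed

lemma finsum_residue_class:
  fixes f :: "'i \<Rightarrow> 'a::field nc_poly"
  assumes "finite I" "\<And>i. i \<in> I \<Longrightarrow> f i \<in> homogeneous d"
  shows "finsum (graded_piece d) (\<lambda>i. residue_class n (f i)) I = residue_class n (\<Sum>i\<in>I. f i)
    \<and> (\<Sum>i\<in>I. f i) \<in> homogeneous d"
  using assms
proof (induction rule: finite_induct)
  interpret vectorspace class_ring "graded_piece d :: ('a, 'a nc_poly set) module"
    by (rule vectorspace_graded_piece)
  case empty
  show ?case by (simp add: graded_piece_simps(3) homogeneous_closed(1))
next
  interpret V: vectorspace class_ring "graded_piece d :: ('a, 'a nc_poly set) module"
    by (rule vectorspace_graded_piece)
  case (insert i I)
  have c: "residue_class n (f j) \<in> carrier (graded_piece d)" if "j \<in> insert i I" for j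
    unfolding graded_piece_carrier using insert.prems that by blast
  have "finsum (graded_piece d) (\<lambda>i. residue_class n (f i)) (insert i I)
      = residue_class n (f i) \<oplus>\<^bsub>graded_piece d\<^esub> finsum (graded_piece d) (\<lambda>i. residue_class n (f i)) I"
    using insert.hyps c by (intro V.finsum_insert) blast+
  also have "\<dots> = residue_class n (f i + (\<Sum>i\<in>I. f i))"
    using insert by (simp add: graded_piece_simps(1))
  finally show ?case using insert by (simp add: homogeneous_closed(2))
qed

text \<open>
  A homogeneous element of degree \<open>d\<close> has nonzero coefficients only at matchings with \<open>d\<close> edges, and
  the sum of the corresponding monomials with these coefficients is an element with the same
  coefficients, hence of the same class.
\<close>

lemma matchings_identity_resolution:
  "identity_resolution (graded_piece d :: ('a::field, 'a nc_poly set) module) {S. matching n S \<and> card S = d}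
     (\<lambda>S. residue_class n (Poly_Mapping.single (matching_word S) 1)) class_coeff"
    (is "identity_resolution ?V ?M ?e _")
  unfolding identity_resolution_def
proof (intro conjI ballI)
  show fin: "finite ?M" by (rule finite_subset[OF _ finite_matchings[OF n]]) auto
  show "?e \<in> ?M \<rightarrow> carrier ?V"
    unfolding graded_piece_carrier using matching_monomial_homogeneous by blast
  show "linear_form ?V (class_coeff S)" if S: "S \<in> ?M" for S
    unfolding linear_form_def graded_piece_carrier
  proof (intro conjI ballI allI)
    fix v w :: "'a nc_poly set"
    assume "v \<in> residue_class n ` homogeneous d" "w \<in> residue_class n ` homogeneous d"
    then obtain p q where pq: "p \<in> homogeneous d" "v = residue_class n p"
        "q \<in> homogeneous d" "w = residue_class n q" by blast
    then show "class_coeff S (v \<oplus>\<^bsub>?V\<^esub> w) = class_coeff S v + class_coeff S w"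
      unfolding pq(2,4) graded_piece_simps(1)[OF pq(1,3)]
      using S homogeneous_closed(2)[OF pq(1,3)]
      by (simp add: class_coeff_residue_class homogeneous_keys coeff_add)
  next
    fix k :: 'a and v :: "'a nc_poly set" assume "v \<in> residue_class n ` homogeneous d"
    then obtain p where p: "p \<in> homogeneous d" "v = residue_class n p" by blast
    show "class_coeff S (k \<odot>\<^bsub>?V\<^esub> v) = k * class_coeff S v"
      unfolding p(2) graded_piece_simps(2)[OF p(1)]
      using S homogeneous_keys[OF p(1)] homogeneous_keys[OF homogeneous_closed(3)[OF p(1)]]
      by (simp add: class_coeff_residue_class coeff_scalar_mult)
  qed
next
  fix v assume "v \<in> carrier ?V"
  then obtain p where p: "p \<in> homogeneous d" "v = residue_class n p"
    unfolding graded_piece_carrier by blast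
  let ?q = "\<Sum>S\<in>?M. Poly_Mapping.single (matching_word S) (coeff S p)"
  have fin: "finite ?M" by (rule finite_subset[OF _ finite_matchings[OF n]]) auto
  interpret V: vectorspace class_ring ?V by (rule vectorspace_graded_piece)
  have summand: "class_coeff S v \<odot>\<^bsub>?V\<^esub> ?e S = residue_class n (Poly_Mapping.single (matching_word S) (coeff S p))"
    if "S \<in> ?M" for S
    using that p(1) graded_piece_simps(2)[OF matching_monomial_homogeneous[of S d 1], of "coeff S p"]
    unfolding p(2) by (simp add: class_coeff_residue_class homogeneous_keys scalar_def mult_single plus_list_def)
  have q: "?q \<in> homogeneous d"
    using finsum_residue_class[of ?M "\<lambda>S. Poly_Mapping.single (matching_word S) (coeff S p)" d]
      fin matching_monomial_homogeneous by auto
  have "finsum ?V (\<lambda>S. class_coeff S v \<odot>\<^bsub>?V\<^esub> ?e S) ?M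
      = finsum ?V (\<lambda>S. residue_class n (Poly_Mapping.single (matching_word S) (coeff S p))) ?M"
    using summand matching_monomial_homogeneous
    by (intro V.finsum_cong') (auto simp: graded_piece_carrier intro!: imageI matching_monomial_homogeneous)
  also have "\<dots> = residue_class n ?q"
    using finsum_residue_class[of ?M "\<lambda>S. Poly_Mapping.single (matching_word S) (coeff S p)" d]
      fin matching_monomial_homogeneous by auto
  also have "residue_class n ?q = residue_class n p"
  proof -
    have "coeff U ?q = coeff U p" if U: "matching n U" for U
    proof -
      have "coeff U ?q = (\<Sum>S\<in>?M. if S = U then coeff U p else 0)"
        unfolding coeff_sum by (rule sum.cong) (auto simp: coeff_matching_word[OF n])
      then show ?thesis using coeff_homogeneous[OF p(1), of U] U fin by (auto simp: sum.delta)
    qed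
    then show ?thesis
      using residue_class_eq_iff[OF homogeneous_keys[OF q] homogeneous_keys[OF p(1)]] by blast
  qed
  finally show "v = finsum ?V (\<lambda>S. class_coeff S v \<odot>\<^bsub>?V\<^esub> ?e S) ?M" using p(2) by simp
qed

lemma reflection_scalar_add:
  fixes p q :: "'a::field nc_poly"
  assumes "p \<in> homogeneous d" "q \<in> homogeneous d"
  shows "residue_class n (nc_subst (cycle_reflection n) (p + q))
       = residue_class n (nc_subst (cycle_reflection n) p + nc_subst (cycle_reflection n) q)"
    and "residue_class n (nc_subst (cycle_reflection n) (scalar c * p))
       = residue_class n (scalar c * nc_subst (cycle_reflection n) p)"
proof -
  note k = homogeneous_keys[OF assms(1)] homogeneous_keys[OF assms(2)]
  show "residue_class n (nc_subst (cycle_reflection n) (p + q))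
       = residue_class n (nc_subst (cycle_reflection n) p + nc_subst (cycle_reflection n) q)"
    using k by (subst residue_class_eq_iff)
      (simp_all add: reflection_carrier carrier_closed coeff_reflection coeff_add distrib_left)
  show "residue_class n (nc_subst (cycle_reflection n) (scalar c * p))
       = residue_class n (scalar c * nc_subst (cycle_reflection n) p)"
    using k keys_scalar[of c "cycle_edges n"] by (subst residue_class_eq_iff)
      (simp_all add: reflection_carrier carrier_closed coeff_reflection coeff_scalar_mult)
qed

lemma linear_endo_reflection:
  "linear_endo (graded_piece d :: ('a::field, 'a nc_poly set) module) (FK_action n (cycle_reflection n))"
    (is "linear_endo ?V ?T")
proof -
  have T: "?T (residue_class n p) = residue_class n (nc_subst (cycle_reflection n) p)"
    "nc_subst (cycle_reflection n) p \<in> homogeneous d" if "p \<in> homogeneous d" for p :: "'a nc_poly"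
    using that FK_action_residue_class[of p] reflection_carrier[of p] reflection_homogeneous[of p d]
    by (simp_all add: homogeneous_def)
  show ?thesis
    unfolding linear_endo_def graded_piece_carrier
  proof (intro conjI ballI allI)
    show "?T \<in> residue_class n ` homogeneous d \<rightarrow> residue_class n ` homogeneous d"
      using T by auto
  next
    fix v w :: "'a nc_poly set"
    assume "v \<in> residue_class n ` homogeneous d" "w \<in> residue_class n ` homogeneous d"
    then obtain p q where pq: "p \<in> homogeneous d" "v = residue_class n p"
        "q \<in> homogeneous d" "w = residue_class n q" by blast
    then show "?T (v \<oplus>\<^bsub>?V\<^esub> w) = ?T v \<oplus>\<^bsub>?V\<^esub> ?T w"
      using reflection_scalar_add(1)[OF pq(1,3)] homogeneous_closed(2)[OF pq(1,3)] T
      by (simp add: graded_piece_simps(1))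
  next
    fix k :: 'a and v :: "'a nc_poly set" assume "v \<in> residue_class n ` homogeneous d"
    then obtain p where p: "p \<in> homogeneous d" "v = residue_class n p" by blast
    then show "?T (k \<odot>\<^bsub>?V\<^esub> v) = k \<odot>\<^bsub>?V\<^esub> ?T v"
      using reflection_scalar_add(2)[OF p(1) p(1)] homogeneous_closed(3)[OF p(1)] T
      by (simp add: graded_piece_simps(2))
  qed
qed

text \<open>
  Up to the sign \<open>(-1) ^ d\<close> the reflection permutes the matching monomials of degree \<open>d\<close>, so only the
  invariant matchings contribute to the trace.
\<close>

lemma lin_trace_reflection:
  "lin_trace (graded_piece d :: ('a::field, 'a nc_poly set) module) (FK_action n (cycle_reflection n))
    = (\<Sum>S | matching n S \<and> card S = d. (-1) ^ d * of_bool (reflect_edge n ` S = S))"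
proof -
  have "class_coeff S (FK_action n (cycle_reflection n) (residue_class n (Poly_Mapping.single (matching_word S) (1 :: 'a))))
      = (-1) ^ d * of_bool (reflect_edge n ` S = S)" if S: "matching n S" "card S = d" for S
  proof -
    have k: "Poly_Mapping.keys (Poly_Mapping.single (matching_word S) (1 :: 'a)) \<subseteq> lists (cycle_edges n)"
      by (rule homogeneous_keys[OF matching_monomial_homogeneous[OF S]])
    show ?thesis
      using S by (simp add: FK_action_residue_class[OF k] class_coeff_residue_class[OF reflection_carrier[OF k]]
        coeff_reflection[OF k] coeff_matching_word[OF n])
  qed
  then show ?thesis
    unfolding lin_trace_eq_resolution[OF vectorspace_graded_piece matchings_identity_resolution linear_endo_reflection]
    by (intro sum.cong) auto
qed

lemma graded_trace_reflection:
  "graded_trace n (cycle_reflection n)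
    = (\<Sum>S | matching n S \<and> reflect_edge n ` S = S. (- fps_X) ^ card S :: 'a::field fps)"
proof (rule fps_ext)
  fix d
  have fin: "finite {S. matching n S \<and> P S}" for P
    by (rule finite_subset[OF _ finite_matchings[OF n]]) auto
  have nth: "fps_nth ((- fps_X) ^ k :: 'a fps) d = (if k = d then (-1) ^ d else 0)" for k
  proof -
    have "- fps_X = fps_const (-1) * (fps_X :: 'a fps)" by (simp flip: fps_const_neg)
    then have "(- fps_X) ^ k = fps_const ((-1) ^ k) * (fps_X :: 'a fps) ^ k"
      by (simp only: power_mult_distrib fps_const_power)
    then show ?thesis by (simp only: fps_mult_left_const_nth fps_X_power_nth) simp
  qed
  have "fps_nth (graded_trace n (cycle_reflection n)) d
      = (\<Sum>S | matching n S \<and> card S = d. (-1) ^ d * of_bool (reflect_edge n ` S = S) :: 'a)"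
    by (simp add: graded_trace_def lin_trace_reflection flip: graded_piece_def)
  also have "\<dots> = (\<Sum>S | matching n S. if card S = d \<and> reflect_edge n ` S = S then (-1) ^ d else 0)"
    by (rule sum.mono_neutral_cong_left) (use finite_matchings[OF n] in auto)
  also have "\<dots> = (\<Sum>S | matching n S \<and> reflect_edge n ` S = S. if card S = d then (-1) ^ d else 0)"
    by (rule sum.mono_neutral_cong_right) (use finite_matchings[OF n] in auto)
  also have "\<dots> = fps_nth (\<Sum>S | matching n S \<and> reflect_edge n ` S = S. (- fps_X) ^ card S :: 'a fps) d"
    by (simp add: fps_sum_nth nth)
  finally show "fps_nth (graded_trace n (cycle_reflection n)) d
      = fps_nth (\<Sum>S | matching n S \<and> reflect_edge n ` S = S. (- fps_X) ^ card S :: 'a fps) d" .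
qed

end

theorem lemma2p20:
  fixes n :: nat
  assumes "n \<ge> 4" and "even n"
  shows "(graded_trace n (cycle_reflection n) :: 'a::field fps) =
           (\<Sum>k = 0..n div 4. of_nat ((n div 2 - k) choose k) * fps_X ^ (2 * k))
           - 2 * (\<Sum>k = 0..(n div 2 - 1) div 2.
                    of_nat ((n div 2 - 1 - k) choose k) * fps_X ^ (2 * k + 1))
           + (\<Sum>k = 0..(n div 2 - 2) div 2.
                of_nat ((n div 2 - 2 - k) choose k) * fps_X ^ (2 * k + 2))
       \<and> (graded_trace n (cycle_reflection n) :: 'a fps) =
           q_fib (n div 2) (fps_X ^ 2)
           - 2 * fps_X * q_fib (n div 2 - 1) (fps_X ^ 2)
           + fps_X ^ 2 * q_fib (n div 2 - 2) (fps_X ^ 2)"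
proof -
  define h where "h = n div 2"
  have h: "n = 2 * h" using assms(2) by (simp add: h_def)
  have div4: "n div 4 = h div 2" using h by simp
  have "(graded_trace n (cycle_reflection n) :: 'a fps)
      = q_fib h ((- fps_X) ^ 2) + 2 * (- fps_X) * q_fib (h - 1) ((- fps_X) ^ 2)
        + (- fps_X) ^ 2 * q_fib (h - 2) ((- fps_X) ^ 2)"
    unfolding graded_trace_reflection[OF assms(1)] by (rule sum_symmetric_matchings[OF assms(1) h])
  then have fib: "(graded_trace n (cycle_reflection n) :: 'a fps)
      = q_fib h (fps_X ^ 2) - 2 * fps_X * q_fib (h - 1) (fps_X ^ 2) + fps_X ^ 2 * q_fib (h - 2) (fps_X ^ 2)"
    by simp
  have expand: "fps_X ^ j * q_fib m (fps_X ^ 2)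
      = (\<Sum>k = 0..m div 2. of_nat ((m - k) choose k) * (fps_X :: 'a fps) ^ (2 * k + j))" for j m
    by (simp add: q_fib_def sum_distrib_left power_add ac_simps flip: power_mult)
  show ?thesis
    using fib expand[of 0 h] expand[of 1 "h - 1"] expand[of 2 "h - 2"]
    unfolding div4 h_def[symmetric] by (simp add: mult.assoc)
qed

end
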